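(* Let $M$ be a loopless matroid on $E=\{0,1,\dots,n\}$ and let $S$ be a nonempty subset of $E$. Let $H_S$ be the matroid on $E$ whose bases are $\{E\setminus i : i\in S\}$, and let $F=\operatorname{cl}_M(S)$ be the smallest flat of $M$ containing $S$. Then $H_S\wedge M=T_F(M)$, and the divisor class $h_S\in A^1(\Sigma_{A_n})$ satisfies \[ h_S\cap\Delta_M=\begin{cases}\Delta_{T_F(M)} & \text{if } \operatorname{rk}_M(S)>1,\\ 0 & \text{otherwise.}\end{cases} \]
   Context: Let $N=\mathbb Z^E/\mathbb Z\mathbf e_E$ where $\mathbf e_S=\sum_{i\in S}\mathbf e_i$, and let $u_S$ be the image of $\mathbf e_S$ in $N$. The braid fan $\Sigma_{A_n}\subset N_{\mathbb R}$ is the complete smooth fan whose cones are $\operatorname{Cone}(u_{S_1},\dots,u_{S_k})$ for chains $\emptyset\subsetneq S_1\subsetneq\cdots\subsetneq S_k\subsetneq E$. For a smooth fan $\Sigma$, its Chow ring is $A^\bullet(\Sigma)=\mathbb R[x_\rho:\rho\in\Sigma(1)]/(\langle\prod_{\rho\in T}x_\rho : T \text{ not a cone}\rangle+\langle\sum_\rho m(u_\rho)x_\rho : m\in N^\vee\rangle)$; for $\Sigma_{A_n}$ write $x_T$ for the variable of the ray $u_T$. An $\ell$-dimensional Minkowski weight is a function $\Delta:\Sigma(\ell)\to\mathbb R$ such that for each $\tau\in\Sigma(\ell-1)$, $\sum_{\sigma\succ\tau}\Delta(\sigma)u_{\sigma\setminus\tau}\in\operatorname{span}(\tau)$; they form $\operatorname{MW}_\ell(\Sigma)$.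 Every element of $A^\ell(\Sigma)$ is a linear combination of monomials $\prod_{\rho\in\sigma}x_\rho$ ($\sigma\in\Sigma(\ell)$), and for $\Delta\in \operatorname{MW}_\ell(\Sigma)$ the rule $\prod_{\rho\in\sigma}x_\rho\mapsto\Delta(\sigma)$ gives a well-defined linear functional on $A^\ell(\Sigma)$. The cap product $\xi\cap\Delta\in\operatorname{MW}_{\ell-k}(\Sigma)$ of $\xi\in A^k(\Sigma)$ and $\Delta\in\operatorname{MW}_\ell(\Sigma)$ is $\sigma\mapsto$ (this functional of $\Delta$ applied to $\xi\cdot\prod_{\rho\in\sigma}x_\rho$). Let $\alpha=\sum_{i\in T\subsetneq E}x_T\in A^1(\Sigma_{A_n})$ (independent of $i$), and for nonempty $S\subseteq E$ put $h_S=\alpha-\sum_{S\subseteq T\subsetneq E}x_T\in A^1(\Sigma_{A_n})$. For a loopless matroid $M$ of rank $d+1$ on $E$, its Bergman class $\Delta_M\in\operatorname{MW}_d(\Sigma_{A_n})$ takes value $1$ on $\operatorname{Cone}(u_{F_1},\dots,u_{F_d})$ when all $F_i$ are flats of $M$, and $0$ otherwise. The principal truncation $T_F(M)$ is the matroid with bases $\{B\setminus f: B \text{ a basis of } M,\ f\in B\cap F\}$. The matroid intersection $M\wedge N$ of matroids on $E$ is the matroid whose spanning sets are $\{S\cap S': S \text{ spanning in } M, S' \text{ spanning in } N\}$. *)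

theory Defs
  imports Complex_Main "HOL-Library.Poly_Mapping"
begin

definition matroid_bases :: "'a set \<Rightarrow> 'a set set \<Rightarrow> bool" where
  "matroid_bases E \<B> \<longleftrightarrow> finite E \<and> \<B> \<noteq> {} \<and> (\<forall>B\<in>\<B>. B \<subseteq> E) \<and>
     (\<forall>B1\<in>\<B>. \<forall>B2\<in>\<B>. \<forall>x\<in>B1 - B2. \<exists>y\<in>B2 - B1. insert y (B1 - {x}) \<in> \<B>)"

definition loopless :: "'a set \<Rightarrow> 'a set set \<Rightarrow> bool" where
  "loopless E \<B> \<longleftrightarrow> (\<forall>e\<in>E. \<exists>B\<in>\<B>. e \<in> B)"

definition mrank :: "'a set set \<Rightarrow> 'a set \<Rightarrow> nat" where
  "mrank \<B> X = Max ((\<lambda>B. card (B \<inter> X)) ` \<B>)"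

definition matroid_rank :: "'a set set \<Rightarrow> nat" where
  "matroid_rank \<B> = card (SOME B. B \<in> \<B>)"

definition is_flat :: "'a set \<Rightarrow> 'a set set \<Rightarrow> 'a set \<Rightarrow> bool" where
  "is_flat E \<B> X \<longleftrightarrow> X \<subseteq> E \<and> (\<forall>e\<in>E - X. mrank \<B> (insert e X) > mrank \<B> X)"

definition mclosure :: "'a set \<Rightarrow> 'a set set \<Rightarrow> 'a set \<Rightarrow> 'a set" where
  "mclosure E \<B> S = \<Inter>{G. is_flat E \<B> G \<and> S \<subseteq> G}"

definition H_bases :: "'a set \<Rightarrow> 'a set \<Rightarrow> 'a set set" where
  "H_bases E S = {E - {i} | i. i \<in> S}"

definition trunc_bases :: "'a set set \<Rightarrow> 'a set \<Rightarrow> 'a set set" where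
  "trunc_bases \<B> F = {B - {f} | B f. B \<in> \<B> \<and> f \<in> B \<inter> F}"

definition spanning_sets :: "'a set \<Rightarrow> 'a set set \<Rightarrow> 'a set set" where
  "spanning_sets E \<B> = {X. X \<subseteq> E \<and> (\<exists>B\<in>\<B>. B \<subseteq> X)}"

definition meet_bases :: "'a set \<Rightarrow> 'a set set \<Rightarrow> 'a set set \<Rightarrow> 'a set set" where
  "meet_bases E \<B>1 \<B>2 =
    (let Sp = {X \<inter> Y | X Y. X \<in> spanning_sets E \<B>1 \<and> Y \<in> spanning_sets E \<B>2}
     in {X \<in> Sp. \<forall>Y\<in>Sp. Y \<subseteq> X \<longrightarrow> Y = X})"

definition rays :: "nat \<Rightarrow> nat set set" where
  "rays n = {T. T \<noteq> {} \<and> T \<subset> {0..n}}"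

definition is_chain :: "nat set set \<Rightarrow> bool" where
  "is_chain C \<longleftrightarrow> (\<forall>A\<in>C. \<forall>B\<in>C. A \<subseteq> B \<or> B \<subseteq> A)"

text \<open>cones of the braid fan, identified with their sets of rays (chains); Sigma(l)\<close>
definition cones :: "nat \<Rightarrow> nat \<Rightarrow> nat set set set" where
  "cones n l = {C. C \<subseteq> rays n \<and> is_chain C \<and> card C = l}"

type_synonym poly = "(nat set \<Rightarrow>\<^sub>0 nat) \<Rightarrow>\<^sub>0 real"

definition var :: "nat set \<Rightarrow> poly" where
  "var T = Poly_Mapping.single (Poly_Mapping.single T 1) 1"

definition mono :: "nat set set \<Rightarrow> poly" where
  "mono C = (\<Prod>T\<in>C. var T)"

inductive_set ideal_gen :: "poly set \<Rightarrow> poly set" for G where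
  zero: "0 \<in> ideal_gen G"
| gen: "g \<in> G \<Longrightarrow> q * g \<in> ideal_gen G"
| add: "p \<in> ideal_gen G \<Longrightarrow> r \<in> ideal_gen G \<Longrightarrow> p + r \<in> ideal_gen G"

text \<open>Stanley-Reisner generators (non-faces) and linear generators sum_rho m(u_rho) x_rho,
  m in the dual lattice: integer vectors on E with sum of coordinates 0 (so m(e_E) = 0)\<close>
definition chow_ideal :: "nat \<Rightarrow> poly set" where
  "chow_ideal n = ideal_gen
     ({mono C | C. C \<subseteq> rays n \<and> \<not> is_chain C} \<union>
      {(\<Sum>T\<in>rays n. of_int (\<Sum>i\<in>T. m i) * var T) | m :: nat \<Rightarrow> int. (\<Sum>i\<in>{0..n}. m i) = 0})"

text \<open>the linear functional on A^l determined by a weight Delta on Sigma(l)\<close>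
definition deg_fun :: "nat \<Rightarrow> nat \<Rightarrow> (nat set set \<Rightarrow> real) \<Rightarrow> poly \<Rightarrow> real" where
  "deg_fun n l \<Delta> p = (THE c. \<exists>a :: nat set set \<Rightarrow> real.
      p - (\<Sum>\<sigma>\<in>cones n l. Poly_Mapping.single 0 (a \<sigma>) * mono \<sigma>) \<in> chow_ideal n \<and>
      c = (\<Sum>\<sigma>\<in>cones n l. a \<sigma> * \<Delta> \<sigma>))"

text \<open>cap product of a class xi in A^k (given by a representative polynomial of degree k)
  with Delta in MW_l, evaluated at a cone sigma in Sigma(l-k)\<close>
definition cap :: "nat \<Rightarrow> nat \<Rightarrow> poly \<Rightarrow> (nat set set \<Rightarrow> real) \<Rightarrow> nat set set \<Rightarrow> real" where
  "cap n l \<xi> \<Delta> \<sigma> = deg_fun n l \<Delta> (\<xi> * mono \<sigma>)"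

text \<open>alpha = sum of x_T over rays T containing i (we take i = 0)\<close>
definition alpha :: "nat \<Rightarrow> poly" where
  "alpha n = (\<Sum>T\<in>{T \<in> rays n. 0 \<in> T}. var T)"

definition h_div :: "nat \<Rightarrow> nat set \<Rightarrow> poly" where
  "h_div n S = alpha n - (\<Sum>T\<in>{T \<in> rays n. S \<subseteq> T}. var T)"

definition bergman :: "nat \<Rightarrow> nat set set \<Rightarrow> nat set set \<Rightarrow> real" where
  "bergman n \<B> \<sigma> = (if \<forall>F\<in>\<sigma>. is_flat {0..n} \<B> F then 1 else 0)"

end

theory Submission
  imports Defs "HOL-Library.Multiset"
begin

text \<open>
A piecewise linear function f on the fan acts on balanced weights by the tropical divisor: at a
cone it sums f - m against the weights of the cones one dimension higher, where m is a linear
function agreeing with f on the cone. Expanding two successive divisors gives an expression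
symmetric in the two functions, so divisors are balanced again and commute; hence monomials act
on weights, linear functions and non-faces act by zero, and evaluation at the zero cone is the
functional on the Chow ring attached to a weight. This makes the functional well defined, and the
cap product with a divisor class is a tropical divisor.

A flag of d - 1 proper flats skips exactly one rank, between neighbours G and H say, and the flats
T that refine it cut H - G into the blocks T - G. This partition gives the balancing of the Bergman
class, and it evaluates the divisor of h at the flag to 1 if S lies in H but in none of the T, and
to 0 otherwise. The first case means that all members of the flag remain flats in the principal
truncation and that S has rank at least 2.
\<close>

subsection \<open>Matroids given by bases\<close>

locale matroid =
  fixes E :: "'a set" and \<B> :: "'a set set"
  assumes matroid_bases: "matroid_bases E \<B>"
begin

abbreviation r :: "'a set \<Rightarrow> nat" where "r \<equiv> mrank \<B>"

definition indep :: "'a set \<Rightarrow> bool" where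
  "indep I \<longleftrightarrow> (\<exists>B\<in>\<B>. I \<subseteq> B)"

text \<open>The closure in terms of rank; \<open>mclosure_eq_cl\<close> identifies it with the
  intersection of flats in \<open>mclosure\<close>.\<close>

definition cl :: "'a set \<Rightarrow> 'a set" where
  "cl X = {e \<in> E. r (insert e X) = r X}"

lemma finite_ground: "finite E" and bases_nonempty: "\<B> \<noteq> {}"
  and basis_subset: "B \<in> \<B> \<Longrightarrow> B \<subseteq> E"
  using matroid_bases by (auto simp: matroid_bases_def)

lemma exchange:
  assumes "B1 \<in> \<B>" "B2 \<in> \<B>" "x \<in> B1 - B2"
  obtains y where "y \<in> B2 - B1" "insert y (B1 - {x}) \<in> \<B>"
  using matroid_bases assms unfolding matroid_bases_def by meson

lemma finite_basis: "B \<in> \<B> \<Longrightarrow> finite B"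
  using basis_subset finite_ground finite_subset by blast

lemma finite_bases: "finite \<B>"
  using basis_subset finite_ground by (meson PowI finite_Pow_iff finite_subset subsetI)

lemma indep_subset: "indep J \<Longrightarrow> I \<subseteq> J \<Longrightarrow> indep I"
  unfolding indep_def by blast

lemma indep_finite: "indep I \<Longrightarrow> finite I"
  using finite_basis finite_subset unfolding indep_def by blast

lemma basis_indep: "B \<in> \<B> \<Longrightarrow> indep B"
  unfolding indep_def by blast

text \<open>An exchange with \<open>B2\<close> keeps the size of \<open>B1\<close> and shrinks
  \<open>B1 - B2\<close>, until one basis contains the other; a proper inclusion would violate
  exchange.\<close>

lemma basis_card_eq:
  assumes "B1 \<in> \<B>" "B2 \<in> \<B>"
  shows "card B1 = card B2"
  using assms
proof (induction "card (B1 - B2)" arbitrary: B1 rule: less_induct)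
  case less
  show ?case
  proof (cases "B1 \<subseteq> B2")
    case True
    have "B2 \<subseteq> B1"
      using exchange[OF less.prems(2,1)] True by blast
    with True show ?thesis by simp
  next
    case False
    then obtain x where x: "x \<in> B1 - B2" by blast
    from exchange[OF less.prems x] obtain y
      where y: "y \<in> B2 - B1" "insert y (B1 - {x}) \<in> \<B>" .
    have fin: "finite B1" using finite_basis less.prems(1) .
    have "insert y (B1 - {x}) - B2 = (B1 - B2) - {x}" using y by blast
    then have "card (insert y (B1 - {x}) - B2) < card (B1 - B2)"
      using x fin by (metis card_Diff1_less finite_Diff)
    then have "card (insert y (B1 - {x})) = card B2"
      using less.hyps less.prems(2) y(2) by blast
    moreover have "card (insert y (B1 - {x})) = card B1"
      using x y(1) fin card_Suc_Diff1[of B1 x] by simp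
    ultimately show ?thesis by simp
  qed
qed

text \<open>Extend \<open>I\<close> and \<open>J\<close> to bases, the one over \<open>J\<close>
  with as few elements outside \<open>J \<union> B1\<close> as possible. If no augmentation existed,
  exchange would give \<open>card (B1 - B2) \<le> card (I - J) < card (J - I) \<le> card (B2 -
  B1)\<close>, against the equal sizes of bases.\<close>

lemma augment:
  assumes "indep I" "indep J" "card I < card J"
  obtains e where "e \<in> J - I" "indep (insert e I)"
proof (rule ccontr)
  note that' = that
  assume "\<not> thesis"
  then have fail: "\<not> indep (insert e I)" if "e \<in> J - I" for e
    using that that' by blast
  obtain B1 where B1: "B1 \<in> \<B>" "I \<subseteq> B1" using assms(1) unfolding indep_def by blast
  have "\<exists>B. B \<in> \<B> \<and> J \<subseteq> B" using assms(2) unfolding indep_def by blast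
  then obtain B2 where B2: "B2 \<in> \<B>" "J \<subseteq> B2"
    and minimal: "\<And>B. B \<in> \<B> \<Longrightarrow> J \<subseteq> B \<Longrightarrow> card (B2 - (J \<union> B1)) \<le> card (B - (J \<union> B1))"
    using ex_has_least_nat[of "\<lambda>B. B \<in> \<B> \<and> J \<subseteq> B" _ "\<lambda>B. card (B - (J \<union> B1))"] by metis
  have JB1: "J \<inter> B1 \<subseteq> I"
    using fail B1 unfolding indep_def by blast
  have B2_sub: "B2 \<subseteq> J \<union> B1"
  proof (rule ccontr)
    assume "\<not> B2 \<subseteq> J \<union> B1"
    then obtain x where x: "x \<in> B2 - (J \<union> B1)" by blast
    then obtain y where y: "y \<in> B1 - B2" "insert y (B2 - {x}) \<in> \<B>"
      using exchange[OF B2(1) B1(1)] by blast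
    have "insert y (B2 - {x}) - (J \<union> B1) = (B2 - (J \<union> B1)) - {x}" using y by blast
    then have "card (insert y (B2 - {x}) - (J \<union> B1)) < card (B2 - (J \<union> B1))"
      using x finite_basis[OF B2(1)] by (metis card_Diff1_less finite_Diff)
    then show False using minimal[OF y(2)] x B2(2) by fastforce
  qed
  \<comment> \<open>An \<open>x\<close> in \<open>B1\<close> but outside \<open>I\<close> and
    \<open>B2\<close> could be exchanged for some \<open>y \<in> J - I\<close>; as \<open>x\<close>
    is not in \<open>I\<close>, the new basis would contain \<open>insert y I\<close>.\<close>
  have B1_sub: "B1 \<subseteq> I \<union> B2"
  proof (rule ccontr)
    assume "\<not> B1 \<subseteq> I \<union> B2"
    then obtain x where x: "x \<in> B1 - (I \<union> B2)" by blast
    then obtain y where y: "y \<in> B2 - B1" "insert y (B1 - {x}) \<in> \<B>"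
      using exchange[OF B1(1) B2(1)] by blast
    then have "y \<in> J - I" using B2_sub B1 by blast
    moreover have "indep (insert y I)"
      unfolding indep_def by (rule bexI[OF _ y(2)]) (use x B1(2) in blast)
    ultimately show False using fail by blast
  qed
  have fin: "finite B1" "finite B2" using finite_basis B1 B2 by auto
  have "card (B1 - B2) = card (B2 - B1)"
    using basis_card_eq[OF B1(1) B2(1)] fin
    by (metis card_le_sym_Diff le_antisym order_refl)
  moreover have "card (J - I) \<le> card (B2 - B1)"
    using JB1 B2(2) fin by (intro card_mono) auto
  moreover have "card (B1 - B2) \<le> card (I - J)"
    using B1_sub B2(2) indep_finite[OF assms(1)] by (intro card_mono) auto
  moreover have "card (I - J) < card (J - I)"
    using assms(3) indep_finite assms(1,2) by (metis card_less_sym_Diff)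
  ultimately show False by simp
qed

section \<open>The rank function\<close>

lemma indep_card_le_rank:
  assumes "indep I" "I \<subseteq> X"
  shows "card I \<le> r X"
proof -
  obtain B where B: "B \<in> \<B>" "I \<subseteq> B" using assms unfolding indep_def by blast
  then have "card I \<le> card (B \<inter> X)"
    using assms(2) finite_basis by (intro card_mono) auto
  also have "\<dots> \<le> r X"
    unfolding mrank_def using finite_bases B by (intro Max_ge) auto
  finally show ?thesis .
qed

lemma rank_witness:
  obtains I where "indep I" "I \<subseteq> X" "card I = r X"
proof -
  have "r X \<in> (\<lambda>B. card (B \<inter> X)) ` \<B>"
    unfolding mrank_def using finite_bases bases_nonempty by (intro Max_in) auto
  then obtain B where "B \<in> \<B>" "card (B \<inter> X) = r X" by force
  then show thesis using that[of "B \<inter> X"] indep_def by auto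
qed

lemma indep_extend:
  assumes "indep I" "I \<subseteq> X"
  obtains J where "indep J" "I \<subseteq> J" "J \<subseteq> X" "card J = r X"
proof -
  have "\<exists>J. indep J \<and> I \<subseteq> J \<and> J \<subseteq> X \<and> card J = r X"
    using assms
  proof (induction "r X - card I" arbitrary: I rule: less_induct)
    case less
    show ?case
    proof (cases "card I = r X")
      case False
      obtain K where K: "indep K" "K \<subseteq> X" "card K = r X" using rank_witness .
      then have lt: "card I < card K"
        using False indep_card_le_rank[OF less.prems] by simp
      from augment[OF less.prems(1) K(1) lt] obtain e
        where e: "e \<in> K - I" "indep (insert e I)" .
      have "r X - card (insert e I) < r X - card I"
        using e lt K indep_finite less.prems by simp
      from less.hyps[OF this e(2)] show ?thesis
        using e K less.prems(2) by blast
    qed (use less.prems in blast)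
  qed
  then show thesis using that by blast
qed

lemma rank_mono: "X \<subseteq> Y \<Longrightarrow> r X \<le> r Y"
  by (metis indep_card_le_rank order_trans rank_witness)

lemma rank_insert_ge: "r X \<le> r (insert e X)"
  by (rule rank_mono) blast

lemma rank_insert_le: "r (insert e X) \<le> Suc (r X)"
proof -
  obtain I where I: "indep I" "I \<subseteq> insert e X" "card I = r (insert e X)" using rank_witness .
  have "card (I - {e}) \<le> r X"
    using I indep_subset by (intro indep_card_le_rank) auto
  then show ?thesis using I(3) card_Diff1_le[of I e] by (simp add: card_Diff_singleton_if split: if_splits)
qed

lemma indep_rank: "indep I \<Longrightarrow> r I = card I"
  by (rule antisym, rule rank_witness[of I]) (metis card_mono indep_finite, simp add: indep_card_le_rank)

text \<open>A largest independent subset of \<open>X\<close> extends to one of \<open>Y\<close>. If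
  \<open>e\<close> raised the rank of \<open>Y\<close>, an augmentation would have to use
  \<open>e\<close>, and \<open>e\<close> would already raise the rank of \<open>X\<close>.\<close>

lemma rank_insert_stable:
  assumes "r (insert e X) = r X" "X \<subseteq> Y"
  shows "r (insert e Y) = r Y"
proof (rule ccontr)
  assume "r (insert e Y) \<noteq> r Y"
  then have lt: "r Y < r (insert e Y)"
    using rank_insert_ge[of Y e] by auto
  obtain I where I: "indep I" "I \<subseteq> X" "card I = r X" using rank_witness .
  from indep_extend[OF I(1)] I(2) assms(2) obtain J
    where J: "indep J" "I \<subseteq> J" "J \<subseteq> Y" "card J = r Y" by blast
  obtain K where K: "indep K" "K \<subseteq> insert e Y" "card K = r (insert e Y)" using rank_witness .
  from augment[OF J(1) K(1)] lt J K obtain f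
    where f: "f \<in> K - J" "indep (insert f J)" by metis
  have "f \<notin> Y"
  proof
    assume "f \<in> Y"
    then have "card (insert f J) \<le> r Y" using f J by (intro indep_card_le_rank) auto
    then show False using f J indep_finite by simp
  qed
  then have "f = e" using f K by blast
  then have "indep (insert e I)" using f J indep_subset by (meson insert_mono)
  then have "card (insert e I) \<le> r (insert e X)" using I by (intro indep_card_le_rank) auto
  moreover have "e \<notin> I" using J f \<open>f = e\<close> by blast
  ultimately show False using I assms(1) indep_finite by simp
qed

lemma rank_empty: "r {} = 0"
  by (rule rank_witness[of "{}"]) simp

lemma rank_ground: "B \<in> \<B> \<Longrightarrow> r E = card B"
proof -
  assume B: "B \<in> \<B>"
  obtain I where I: "indep I" "card I = r E" using rank_witness .
  then obtain B' where B': "B' \<in> \<B>" "I \<subseteq> B'" unfolding indep_def by blast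
  then have "r E \<le> card B" using I finite_basis basis_card_eq[OF B B'(1)] by (metis card_mono)
  moreover have "card B \<le> r E" using B basis_indep basis_subset indep_card_le_rank by blast
  ultimately show ?thesis by simp
qed

lemma matroid_rank_eq: "matroid_rank \<B> = r E"
  using rank_ground[of "SOME B. B \<in> \<B>"] bases_nonempty
  unfolding matroid_rank_def by (metis some_in_eq)

lemma basisI:
  assumes "indep I" "card I = r E" shows "I \<in> \<B>"
proof -
  obtain B where B: "B \<in> \<B>" "I \<subseteq> B" using assms indep_def by blast
  then have "I = B" using assms(2) rank_ground finite_basis by (metis card_subset_eq)
  with B show ?thesis by simp
qed

section \<open>Closure and flats\<close>

lemma cl_ground: "cl X \<subseteq> E"
  unfolding cl_def by blast

lemma cl_superset:
  assumes "X \<subseteq> E" shows "X \<subseteq> cl X"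
proof
  fix e assume "e \<in> X"
  then have "insert e X = X" by blast
  then show "e \<in> cl X" using assms \<open>e \<in> X\<close> by (auto simp: cl_def)
qed

lemma rank_union_cl:
  assumes "A \<subseteq> cl X" shows "r (X \<union> A) = r X"
proof -
  have "finite A"
    by (rule finite_subset[OF order_trans[OF assms cl_ground] finite_ground])
  then show ?thesis using assms
  proof (induction A)
    case (insert a A)
    have "r (insert a (X \<union> A)) = r (X \<union> A)"
      by (rule rank_insert_stable[of a X]) (use insert.prems in \<open>auto simp: cl_def\<close>)
    then show ?case using insert by simp
  qed simp
qed

lemma rank_cl: "X \<subseteq> E \<Longrightarrow> r (cl X) = r X"
  using rank_union_cl[of "cl X" X] cl_superset by (simp add: sup.absorb2)

lemma cl_flat:
  assumes "X \<subseteq> E" shows "is_flat E \<B> (cl X)"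
  unfolding is_flat_def
proof (intro conjI ballI cl_ground)
  fix e assume e: "e \<in> E - cl X"
  then have "r X < r (insert e X)"
    using rank_insert_ge[of X e] by (auto simp: cl_def)
  also have "\<dots> \<le> r (insert e (cl X))"
    using cl_superset[OF assms] by (intro rank_mono) auto
  finally show "r (cl X) < r (insert e (cl X))" using rank_cl[OF assms] by simp
qed

lemma cl_least:
  assumes "is_flat E \<B> G" "X \<subseteq> G" shows "cl X \<subseteq> G"
proof
  fix e assume "e \<in> cl X"
  then have "e \<in> E" "r (insert e X) = r X" by (auto simp: cl_def)
  then have "r (insert e G) = r G" using assms(2) rank_insert_stable by blast
  then show "e \<in> G"
    using assms(1) \<open>e \<in> E\<close> unfolding is_flat_def by (metis DiffI less_irrefl)
qed

lemma mclosure_eq_cl: "X \<subseteq> E \<Longrightarrow> mclosure E \<B> X = cl X"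
  unfolding mclosure_def
  by (rule antisym) (use cl_flat cl_superset in blast, use cl_least in blast)

lemma flat_rank_less:
  assumes "is_flat E \<B> G" "G \<subset> H" "H \<subseteq> E" shows "r G < r H"
proof -
  obtain e where e: "e \<in> H - G" using assms by blast
  then have "r G < r (insert e G)" using assms unfolding is_flat_def by blast
  also have "\<dots> \<le> r H" using e assms by (intro rank_mono) auto
  finally show ?thesis .
qed

lemma ground_flat: "is_flat E \<B> E" by (simp add: is_flat_def)

text \<open>A flat strictly between \<open>G\<close> and \<open>H\<close> that contains
  \<open>e\<close> has rank at most \<open>r G + 1\<close>, which the closure of
  \<open>insert e G\<close> already attains inside it; nested flats of equal rank coincide.\<close>

lemma flat_between:
  assumes G: "is_flat E \<B> G" and H: "is_flat E \<B> H" and GH: "G \<subseteq> H" "r H = r G + 2"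
    and e: "e \<in> H - G"
  shows "is_flat E \<B> T \<and> G \<subset> T \<and> T \<subset> H \<and> e \<in> T \<longleftrightarrow> T = cl (insert e G)"
proof -
  have sub: "insert e G \<subseteq> E" "H \<subseteq> E" using H e GH by (auto simp: is_flat_def)
  have rk: "r (insert e G) = Suc (r G)"
  proof -
    have "r G < r (insert e G)" using G e sub unfolding is_flat_def by blast
    then show ?thesis using rank_insert_le[of e G] by simp
  qed
  show ?thesis
  proof
    assume T: "is_flat E \<B> T \<and> G \<subset> T \<and> T \<subset> H \<and> e \<in> T"
    then have le: "cl (insert e G) \<subseteq> T" by (intro cl_least) auto
    have "r T < r G + 2" using flat_rank_less[of T H] T sub GH by simp
    then have "\<not> r (cl (insert e G)) < r T" using rk rank_cl sub by simp
    then show "T = cl (insert e G)"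
      using le flat_rank_less[OF cl_flat[OF sub(1)]] T unfolding is_flat_def by blast
  next
    assume T: "T = cl (insert e G)"
    have "cl (insert e G) \<subseteq> H" using H e GH by (intro cl_least) auto
    moreover have "r (cl (insert e G)) \<noteq> r H" using rk rank_cl sub GH by simp
    ultimately show "is_flat E \<B> T \<and> G \<subset> T \<and> T \<subset> H \<and> e \<in> T"
      using T cl_flat[OF sub(1)] cl_superset[OF sub(1)] e by blast
  qed
qed

end

section \<open>Principal truncation and the intersection with \<open>H_S\<close>\<close>

locale loopless_matroid = matroid +
  assumes loopless: "loopless E \<B>"
begin

lemma indep_singleton: "e \<in> E \<Longrightarrow> indep {e}"
  using loopless unfolding loopless_def indep_def by blast

lemma empty_flat: "is_flat E \<B> {}"
  using indep_singleton indep_rank by (auto simp: is_flat_def rank_empty)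

text \<open>A set is independent in the truncation iff some \<open>f \<in> F\<close> outside it can
  be added in \<open>M\<close>. If \<open>X\<close> spans \<open>F\<close>, this \<open>f\<close>
  uses up one unit of the rank of \<open>X\<close>; otherwise an \<open>f\<close> outside the
  closure of \<open>X\<close> costs nothing.\<close>

lemma truncation_rank:
  assumes "F \<subseteq> E" "F \<noteq> {}"
  shows "mrank (trunc_bases \<B> F) X = (if F \<subseteq> cl X then r X - 1 else r X)"
proof -
  let ?B = "trunc_bases \<B> F"
  have fin: "finite ((\<lambda>B. card (B \<inter> X)) ` ?B)"
  proof -
    have "?B \<subseteq> Pow E" unfolding trunc_bases_def using basis_subset by blast
    then show ?thesis using finite_ground by (meson finite_Pow_iff finite_imageI finite_subset)
  qed
  have reach: "\<exists>C\<in>?B. k \<le> card (C \<inter> X)"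
    if *: "f \<in> F" "indep (insert f I)" "I \<subseteq> X" "f \<notin> I" "card I = k" for f I k
  proof -
    obtain B where B: "B \<in> \<B>" "insert f I \<subseteq> B" using *(2) unfolding indep_def by blast
    have "k \<le> card ((B - {f}) \<inter> X)"
      unfolding \<open>card I = k\<close>[symmetric] using *(3,4) B(2)
      by (intro card_mono finite_Int disjI1 finite_Diff finite_basis[OF B(1)]) blast
    moreover have "B - {f} \<in> ?B" unfolding trunc_bases_def using *(1) B by blast
    ultimately show ?thesis by blast
  qed
  have upper: "card (C \<inter> X) \<le> (if F \<subseteq> cl X then r X - 1 else r X)" if "C \<in> ?B" for C
  proof -
    obtain B f where Bf: "C = B - {f}" "B \<in> \<B>" "f \<in> B \<inter> F"
      using \<open>C \<in> ?B\<close> unfolding trunc_bases_def by blast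
    have ind: "indep (C \<inter> X)" "indep (insert f (C \<inter> X))" using Bf unfolding indep_def by blast+
    have "card (C \<inter> X) \<le> r X" using ind by (intro indep_card_le_rank) auto
    moreover have "Suc (card (C \<inter> X)) \<le> r X" if "F \<subseteq> cl X"
    proof -
      have "card (insert f (C \<inter> X)) \<le> r (insert f X)"
        using ind by (intro indep_card_le_rank) auto
      also have "\<dots> = r X" using that Bf by (auto simp: cl_def)
      finally show ?thesis using Bf indep_finite[OF ind(1)] by simp
    qed
    ultimately show ?thesis by auto
  qed
  have lower: "\<exists>C\<in>?B. (if F \<subseteq> cl X then r X - 1 else r X) \<le> card (C \<inter> X)"
  proof (cases "F \<subseteq> cl X")
    case True
    obtain f where f: "f \<in> F" using assms by blast
    then have "indep {f}" using indep_singleton assms(1) by blast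
    from indep_extend[OF this, of "insert f X"] obtain J
      where J: "indep J" "{f} \<subseteq> J" "J \<subseteq> insert f X" "card J = r (insert f X)" by auto
    have "r (insert f X) = r X" using True f by (auto simp: cl_def)
    then have "card (J - {f}) = r X - 1" using J by simp
    moreover have "insert f (J - {f}) = J" "J - {f} \<subseteq> X" using J by blast+
    ultimately show ?thesis using reach[of f "J - {f}" "r X - 1"] f J(1) True by auto
  next
    case False
    then obtain f where f: "f \<in> F" "r (insert f X) \<noteq> r X" using assms by (auto simp: cl_def)
    obtain I where I: "indep I" "I \<subseteq> X" "card I = r X" using rank_witness .
    from indep_extend[OF I(1), of "insert f X"] I(2) obtain J
      where J: "indep J" "I \<subseteq> J" "J \<subseteq> insert f X" "card J = r (insert f X)" by blast
    have "\<not> card J \<le> r X" using f J rank_insert_ge[of X f] by auto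
    then have fJ: "f \<in> J" using J indep_card_le_rank by blast
    moreover have "f \<notin> I" using I f(2) by (metis insert_absorb subsetD)
    ultimately show ?thesis
      using reach[of f I] I J f False indep_subset[OF J(1)] by auto
  qed
  have "Max ((\<lambda>B. card (B \<inter> X)) ` ?B) = (if F \<subseteq> cl X then r X - 1 else r X)"
  proof (rule Max_eqI[OF fin])
    show "y \<le> (if F \<subseteq> cl X then r X - 1 else r X)" if "y \<in> (\<lambda>B. card (B \<inter> X)) ` ?B" for y
      using that upper by blast
    obtain C where C: "C \<in> ?B" "(if F \<subseteq> cl X then r X - 1 else r X) \<le> card (C \<inter> X)"
      using lower by blast
    then show "(if F \<subseteq> cl X then r X - 1 else r X) \<in> (\<lambda>B. card (B \<inter> X)) ` ?B"
      using antisym[OF C(2) upper[OF C(1)]] by (rule_tac image_eqI)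
  qed
  then show ?thesis by (simp only: mrank_def[of "trunc_bases \<B> F"])
qed

text \<open>Adding \<open>e\<close> raises the rank in \<open>M\<close> but not in the truncation
  exactly when it is the step at which \<open>F\<close> becomes spanned. So a flat survives if it
  contains \<open>F\<close> already, or if no single element makes it span \<open>F\<close>.\<close>

lemma truncation_flat_iff:
  assumes "F \<subseteq> E" "F \<noteq> {}"
  shows "is_flat E (trunc_bases \<B> F) G \<longleftrightarrow>
    is_flat E \<B> G \<and> (F \<subseteq> G \<or> (\<forall>e\<in>E - G. \<not> F \<subseteq> cl (insert e G)))"
proof (cases "G \<subseteq> E")
  case G: True
  have clG: "cl G = G" if "is_flat E \<B> G"
    by (rule antisym[OF cl_least[OF that order_refl] cl_superset[OF G]])
  \<comment> \<open>For \<open>r G = 0\<close> the natural difference \<open>r G - 1\<close> would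
    be no drop; an element of \<open>F\<close>, not being a loop, excludes this.\<close>
  have pos: "r G > 0" if "F \<subseteq> cl G"
  proof -
    obtain f where f: "f \<in> F" using assms by blast
    then have "r {f} \<le> r (cl G)" using that by (intro rank_mono) auto
    moreover have "r {f} = 1" using indep_rank[OF indep_singleton[of f]] f assms(1) by auto
    ultimately show ?thesis using rank_cl[OF G] by simp
  qed
  have step: "mrank (trunc_bases \<B> F) G < mrank (trunc_bases \<B> F) (insert e G) \<longleftrightarrow>
    r G < r (insert e G) \<and> (F \<subseteq> cl G \<or> \<not> F \<subseteq> cl (insert e G))" if e: "e \<in> E - G" for e
  proof -
    have eG: "insert e G \<subseteq> E" using e G by blast
    have "cl G \<subseteq> cl (insert e G)"
      by (rule cl_least[OF cl_flat[OF eG]]) (use cl_superset[OF eG] in blast)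
    then have "F \<subseteq> cl (insert e G)" if "F \<subseteq> cl G" using that by blast
    moreover note rank_insert_le[of e G] rank_insert_ge[of G e]
    ultimately show ?thesis
      using pos by (cases "F \<subseteq> cl G"; cases "F \<subseteq> cl (insert e G)") (auto simp: truncation_rank[OF assms])
  qed
  have "is_flat E (trunc_bases \<B> F) G \<longleftrightarrow>
      (\<forall>e\<in>E - G. r G < r (insert e G) \<and> (F \<subseteq> cl G \<or> \<not> F \<subseteq> cl (insert e G)))"
    using G step unfolding is_flat_def by simp
  also have "\<dots> \<longleftrightarrow> is_flat E \<B> G \<and> (F \<subseteq> cl G \<or> (\<forall>e\<in>E - G. \<not> F \<subseteq> cl (insert e G)))"
    using G unfolding is_flat_def by blast
  finally show ?thesis using clG by auto
next
  case False then show ?thesis by (simp add: is_flat_def)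
qed

text \<open>If \<open>J = B - {f}\<close> spanned \<open>S\<close>, it would span
  \<open>cl S\<close>, hence \<open>f\<close> and all of \<open>B\<close>. So some
  \<open>i \<in> S\<close> raises the rank of \<open>J\<close>, and \<open>insert i J\<close> is a
  basis.\<close>

lemma trunc_bases_cl:
  assumes "S \<subseteq> E"
  shows "trunc_bases \<B> (cl S) = trunc_bases \<B> S"
proof
  show "trunc_bases \<B> S \<subseteq> trunc_bases \<B> (cl S)"
    unfolding trunc_bases_def using cl_superset[OF assms] by blast
  show "trunc_bases \<B> (cl S) \<subseteq> trunc_bases \<B> S"
  proof
    fix J assume "J \<in> trunc_bases \<B> (cl S)"
    then obtain B f where Bf: "J = B - {f}" "B \<in> \<B>" "f \<in> B" "f \<in> cl S"
      unfolding trunc_bases_def by blast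
    have J: "J \<subseteq> E" "indep J" "Suc (card J) = r E"
      using Bf basis_subset[OF Bf(2)] indep_subset[OF basis_indep[OF Bf(2)], of J]
        rank_ground[OF Bf(2)] card_Suc_Diff1[OF finite_basis[OF Bf(2)] Bf(3)] by auto
    have "\<not> S \<subseteq> cl J"
    proof
      assume "S \<subseteq> cl J"
      then have "f \<in> cl J" using cl_least cl_flat[OF J(1)] Bf by blast
      then have "r B = r J" using Bf by (auto simp: cl_def insert_absorb)
      then show False using J indep_rank[OF J(2)] rank_ground[OF Bf(2)] indep_rank[OF basis_indep[OF Bf(2)]]
        by simp
    qed
    then obtain i where i: "i \<in> S" "r (insert i J) \<noteq> r J" using assms by (auto simp: cl_def)
    then have "r J < r (insert i J)" using rank_insert_ge[of J i] by auto
    then have iJ: "i \<notin> J" "card (insert i J) = r (insert i J)"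
      using rank_insert_le[of i J] indep_rank[OF J(2)] indep_finite[OF J(2)]
      by (auto simp: insert_absorb card_insert_if split: if_splits)
    obtain K where K: "indep K" "K \<subseteq> insert i J" "card K = r (insert i J)" using rank_witness .
    then have "K = insert i J" using iJ J(2) indep_finite
      by (metis card_subset_eq finite_insert)
    then have "insert i J \<in> \<B>" using K J iJ indep_finite[OF J(2)] by (intro basisI) auto
    then show "J \<in> trunc_bases \<B> S"
      unfolding trunc_bases_def using i iJ by (auto intro!: exI[of _ "insert i J"] exI[of _ i])
  qed
qed

text \<open>An intersection of spanning sets contains some \<open>B - {i}\<close> with
  \<open>i \<in> S\<close>. When \<open>i \<notin> B\<close>, looplessness gives a basis through
  \<open>i\<close> inside \<open>insert i B\<close>, so a truncated basis lies below in either case.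
  Truncated bases all have the same size, hence are minimal.\<close>

lemma meet_H_bases:
  assumes S: "S \<subseteq> E" "S \<noteq> {}"
  shows "meet_bases E (H_bases E S) \<B> = trunc_bases \<B> S"
proof -
  define Sp where "Sp = {X \<inter> Y | X Y. X \<in> spanning_sets E (H_bases E S) \<and> Y \<in> spanning_sets E \<B>}"
  have TSp: "trunc_bases \<B> S \<subseteq> Sp"
  proof
    fix J assume "J \<in> trunc_bases \<B> S"
    then obtain B i where Bi: "J = B - {i}" "B \<in> \<B>" "i \<in> B" "i \<in> S"
      unfolding trunc_bases_def by blast
    have "E - {i} \<in> spanning_sets E (H_bases E S)" "B \<in> spanning_sets E \<B>"
      using Bi basis_subset by (auto simp: spanning_sets_def H_bases_def)
    moreover have "J = (E - {i}) \<inter> B" using Bi basis_subset by blast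
    ultimately show "J \<in> Sp" unfolding Sp_def by blast
  qed
  have below: "\<exists>J\<in>trunc_bases \<B> S. J \<subseteq> X" if "X \<in> Sp" for X
  proof -
    obtain X' Y B i where *: "X = X' \<inter> Y" "X' \<subseteq> E" "i \<in> S" "E - {i} \<subseteq> X'" "B \<in> \<B>" "B \<subseteq> Y"
      using \<open>X \<in> Sp\<close> unfolding Sp_def spanning_sets_def H_bases_def by blast
    have BX: "B - {i} \<subseteq> X" using * basis_subset by blast
    show ?thesis
    proof (cases "i \<in> B")
      case True
      then show ?thesis using BX * by (auto simp: trunc_bases_def)
    next
      case False
      have "i \<in> E" using * S by blast
      from indep_extend[OF indep_singleton[OF this], of "insert i B"] obtain J
        where J: "indep J" "{i} \<subseteq> J" "J \<subseteq> insert i B" "card J = r (insert i B)" by auto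
      have "r (insert i B) = r E"
        using rank_insert_ge[of B i] rank_mono[of "insert i B" E] \<open>i \<in> E\<close>
          basis_subset[OF *(5)] rank_ground[OF *(5)] indep_rank[OF basis_indep[OF *(5)]] by auto
      then have "J \<in> \<B>" using J by (intro basisI) auto
      then have "J - {i} \<in> trunc_bases \<B> S" using J * by (auto simp: trunc_bases_def)
      moreover have "J - {i} \<subseteq> X" using J(3) BX False by blast
      ultimately show ?thesis by (rule bexI[rotated])
    qed
  qed
  have card_T: "card J = r E - 1" "finite J" if "J \<in> trunc_bases \<B> S" for J
    using that rank_ground finite_basis by (auto simp: trunc_bases_def)
  have min_T: "Y = X" if XY: "X \<in> trunc_bases \<B> S" "Y \<in> Sp" "Y \<subseteq> X" for X Y
  proof -
    obtain J where J: "J \<in> trunc_bases \<B> S" "J \<subseteq> Y" using below[OF XY(2)] by blast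
    then have "J = X"
      using card_subset_eq[OF card_T(2)[OF XY(1)]] card_T(1) XY by (metis order_trans)
    then show ?thesis using J XY by blast
  qed
  have "{X \<in> Sp. \<forall>Y\<in>Sp. Y \<subseteq> X \<longrightarrow> Y = X} = trunc_bases \<B> S"
  proof (rule subset_antisym; rule subsetI)
    fix X assume "X \<in> {X \<in> Sp. \<forall>Y\<in>Sp. Y \<subseteq> X \<longrightarrow> Y = X}"
    then have X: "X \<in> Sp" "\<And>Y. Y \<in> Sp \<Longrightarrow> Y \<subseteq> X \<Longrightarrow> Y = X" by simp_all
    obtain J where J: "J \<in> trunc_bases \<B> S" "J \<subseteq> X" using below[OF X(1)] by blast
    then have "J = X" using TSp by (intro X(2)) auto
    with J show "X \<in> trunc_bases \<B> S" by simp
  next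
    fix X assume X: "X \<in> trunc_bases \<B> S"
    then have "X \<in> Sp" using TSp by (rule_tac subsetD)
    then show "X \<in> {X \<in> Sp. \<forall>Y\<in>Sp. Y \<subseteq> X \<longrightarrow> Y = X}" using min_T[OF X] by simp
  qed
  then show ?thesis unfolding meet_bases_def Sp_def Let_def .
qed

end

subsection \<open>Balanced weights and the Chow ring of the braid fan\<close>

lemma finite_rays: "finite (rays n)"
  by (rule finite_subset[of _ "Pow {0..n}"]) (auto simp: rays_def)

lemma is_chain_subset: "is_chain C \<Longrightarrow> D \<subseteq> C \<Longrightarrow> is_chain D"
  unfolding is_chain_def by blast

lemma chain_Union_mem:
  assumes "finite C" "is_chain C" "C \<noteq> {}"
  shows "\<Union>C \<in> C"
  using assms(1,3,2)
proof (induction C rule: finite_ne_induct)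
  case (insert a C)
  have "\<Union>C \<in> C" using insert is_chain_subset by blast
  then have "a \<subseteq> \<Union>C \<or> \<Union>C \<subseteq> a" using insert.prems unfolding is_chain_def by blast
  then have "\<Union>(insert a C) = \<Union>C \<or> \<Union>(insert a C) = a" by auto
  then show ?case using \<open>\<Union>C \<in> C\<close> by auto
qed simp

text \<open>The largest member of a chain has a point that no smaller member contains; changing
  \<open>m\<close> there corrects the sum over that member alone. No division occurs, so integer
  values have integer interpolants, which reflects the smoothness of the fan.\<close>

lemma chain_interpolation:
  fixes f :: "nat set \<Rightarrow> 'a::ab_group_add"
  assumes "finite C" "is_chain C" "\<And>T. T \<in> C \<Longrightarrow> finite T \<and> T \<noteq> {}"
  shows "\<exists>m. \<forall>T\<in>C. sum m T = f T"
  using assms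
proof (induction C rule: finite_psubset_induct)
  case (psubset C)
  show ?case
  proof (cases "C = {}")
    case False
    define M where "M = \<Union>C"
    define C' where "C' = C - {M}"
    have M: "M \<in> C" unfolding M_def using chain_Union_mem psubset.hyps psubset.prems(1) False by blast
    have "C' \<subset> C" unfolding C'_def using M by blast
    then obtain m where m: "\<forall>T\<in>C'. sum m T = f T"
      using psubset.IH[of C'] psubset.prems is_chain_subset[of C C'] by blast
    have "\<exists>i\<in>M. i \<notin> \<Union>C'"
    proof (cases "C' = {}")
      case True
      then show ?thesis using psubset.prems(2) M by fastforce
    next
      case False
      have "\<Union>C' \<in> C'"
        using False psubset.hyps psubset.prems(1) is_chain_subset[of C C']
        by (intro chain_Union_mem) (auto simp: C'_def)
      then have "\<Union>C' \<noteq> M" unfolding C'_def by blast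
      moreover have "\<Union>C' \<subseteq> M" unfolding C'_def M_def by blast
      ultimately show ?thesis by blast
    qed
    then obtain i where i: "i \<in> M" "i \<notin> \<Union>C'" by blast
    define m' where "m' = m(i := m i + (f M - sum m M))"
    have "sum m' T = f T" if "T \<in> C'" for T
    proof -
      have "sum m' T = sum m T"
        using i that by (intro sum.cong) (auto simp: m'_def)
      then show ?thesis using m that by simp
    qed
    moreover have "sum m' M = f M"
    proof -
      have "finite M" using psubset.prems(2) M by blast
      moreover have "sum m' (M - {i}) = sum m (M - {i})" by (intro sum.cong) (auto simp: m'_def)
      ultimately show ?thesis using i by (simp add: sum.remove m'_def)
    qed
    ultimately show ?thesis unfolding C'_def by blast
  qed simp
qed

section \<open>Linear functions on cones, balanced weights and tropical divisors\<close>

definition cone :: "nat \<Rightarrow> nat set set \<Rightarrow> bool" where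
  "cone n \<tau> \<longleftrightarrow> \<tau> \<subseteq> rays n \<and> is_chain \<tau>"

lemma cone_subset: "cone n \<tau> \<Longrightarrow> \<sigma> \<subseteq> \<tau> \<Longrightarrow> cone n \<sigma>"
  unfolding cone_def using is_chain_subset by blast

lemma cones_iff: "\<sigma> \<in> cones n l \<longleftrightarrow> cone n \<sigma> \<and> card \<sigma> = l"
  by (auto simp: cones_def cone_def)

text \<open>\<open>m\<close> stands for the linear function with value \<open>sum m T\<close> at
  \<open>u_T\<close>; total sum 0 makes it well defined modulo the all-ones vector. Real values
  serve the weights, integer values the generators of the Chow ideal.\<close>

definition interpolates :: "nat \<Rightarrow> nat set set \<Rightarrow> (nat set \<Rightarrow> 'a) \<Rightarrow> (nat \<Rightarrow> 'a::ab_group_add) \<Rightarrow> bool" where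
  "interpolates n \<tau> f m \<longleftrightarrow> sum m {0..n} = 0 \<and> (\<forall>T\<in>\<tau>. sum m T = f T)"

text \<open>The ground set joins the chain with prescribed value 0, which enforces total sum
  0.\<close>

lemma cone_interpolation:
  assumes "cone n \<tau>" shows "\<exists>m. interpolates n \<tau> f m"
proof -
  let ?C = "insert {0..n} \<tau>"
  have sub: "\<tau> \<subseteq> rays n" "is_chain \<tau>" using assms by (auto simp: cone_def)
  have "finite ?C" using sub finite_rays finite_subset by blast
  moreover have "is_chain ?C"
    using sub unfolding is_chain_def rays_def by fast
  moreover have "\<And>T. T \<in> ?C \<Longrightarrow> finite T \<and> T \<noteq> {}"
    using sub finite_subset[of _ "{0..n}"] by (auto simp: rays_def)
  ultimately obtain m where m: "\<forall>T\<in>?C. sum m T = (if T = {0..n} then 0 else f T)"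
    using chain_interpolation[of ?C "\<lambda>T. if T = {0..n} then 0 else f T"] by blast
  then have "interpolates n \<tau> f m"
    using sub unfolding interpolates_def rays_def by auto
  then show ?thesis by blast
qed

text \<open>Balancing in dual form: a vector lies in the span of \<open>\<tau>\<close> iff every
  linear function vanishing on \<open>\<tau>\<close> kills it. All dimensions are treated at once,
  and vanishing off the fan lets the sum run over all rays outside \<open>\<tau>\<close>.\<close>

definition balanced :: "nat \<Rightarrow> (nat set set \<Rightarrow> real) \<Rightarrow> bool" where
  "balanced n \<Delta> \<longleftrightarrow> (\<forall>\<tau>. \<not> cone n \<tau> \<longrightarrow> \<Delta> \<tau> = 0) \<and>
    (\<forall>\<tau> m. cone n \<tau> \<longrightarrow> interpolates n \<tau> (\<lambda>_. 0) m \<longrightarrow>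
      (\<Sum>T\<in>rays n - \<tau>. sum m T * \<Delta> (insert T \<tau>)) = 0)"

text \<open>The tropical divisor of the piecewise linear function with value f(T) at the ray of T.\<close>

definition divisor :: "nat \<Rightarrow> (nat set \<Rightarrow> real) \<Rightarrow> (nat set set \<Rightarrow> real) \<Rightarrow> nat set set \<Rightarrow> real" where
  "divisor n f \<Delta> \<tau> = (if cone n \<tau> then
     (let m = (SOME m. interpolates n \<tau> f m)
      in \<Sum>T\<in>rays n - \<tau>. (f T - sum m T) * \<Delta> (insert T \<tau>)) else 0)"

text \<open>Two interpolants differ by a linear function vanishing on \<open>\<tau>\<close>, whose
  contribution balancing kills; so the chosen one may be replaced by any other.\<close>

lemma divisor_eq:
  assumes "balanced n \<Delta>" "cone n \<tau>" "interpolates n \<tau> f m"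
  shows "divisor n f \<Delta> \<tau> = (\<Sum>T\<in>rays n - \<tau>. (f T - sum m T) * \<Delta> (insert T \<tau>))"
proof -
  define m' where "m' = (SOME m. interpolates n \<tau> f m)"
  have "interpolates n \<tau> f m'"
    unfolding m'_def using assms(3) by (rule someI[of "interpolates n \<tau> f"])
  then have "interpolates n \<tau> (\<lambda>_. 0) (\<lambda>i. m i - m' i)"
    using assms(3) by (simp add: interpolates_def sum_subtractf)
  then have "(\<Sum>T\<in>rays n - \<tau>. sum (\<lambda>i. m i - m' i) T * \<Delta> (insert T \<tau>)) = 0"
    using assms unfolding balanced_def by blast
  then have "(\<Sum>T\<in>rays n - \<tau>. (f T - sum m' T) * \<Delta> (insert T \<tau>)) =
      (\<Sum>T\<in>rays n - \<tau>. (f T - sum m T) * \<Delta> (insert T \<tau>))"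
    by (simp add: sum_subtractf algebra_simps sum.distrib)
  then show ?thesis using assms(2) by (simp add: divisor_def m'_def Let_def)
qed

text \<open>After expansion of the inner divisor, a term for a pair \<open>T\<close>,
  \<open>U\<close> carries a weight symmetric in the two rays. The correction at \<open>T\<close> is
  the product of the reduced values of \<open>f\<close> and \<open>g\<close> there with a factor
  independent of both.\<close>

lemma divisor_symmetry:
  assumes bal: "balanced n \<Delta>" and \<tau>: "cone n \<tau>"
    and f: "interpolates n \<tau> f mf" and g: "interpolates n \<tau> g mg"
  shows "(\<Sum>T\<in>rays n - \<tau>. (g T - sum mg T) * divisor n f \<Delta> (insert T \<tau>)) =
         (\<Sum>T\<in>rays n - \<tau>. (f T - sum mf T) * divisor n g \<Delta> (insert T \<tau>))"
proof -
  define R where "R = rays n - \<tau>"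
  have finR: "finite R" unfolding R_def using finite_rays by simp
  define W where "W = (\<lambda>T U. \<Delta> (insert U (insert T \<tau>)))"
  have W_sym: "W T U = W U T" for T U by (simp add: W_def insert_commute)
  \<comment> \<open>Linear functions with value 1 at \<open>T\<close> and 0 on
    \<open>\<tau>\<close>. If \<open>insert T \<tau>\<close> is not a cone the choice is arbitrary,
    but then all \<open>W T U\<close> vanish.\<close>
  define e where "e = (\<lambda>T. SOME m. interpolates n (insert T \<tau>) (\<lambda>U. if U = T then 1 else 0 :: real) m)"
  define c where "c = (\<lambda>T. \<Sum>U\<in>R - {T}. sum (e T) U * W T U)"
  have expand: "divisor n h \<Delta> (insert T \<tau>) =
      (\<Sum>U\<in>R - {T}. (h U - sum m U) * W T U) - (h T - sum m T) * c T"
    if T: "T \<in> R" and h: "interpolates n \<tau> h m" for h m T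
  proof (cases "cone n (insert T \<tau>)")
    case True
    have e: "interpolates n (insert T \<tau>) (\<lambda>U. if U = T then 1 else 0) (e T)"
      unfolding e_def using someI_ex[OF cone_interpolation[OF True]] .
    let ?k = "h T - sum m T"
    \<comment> \<open>Adding \<open>?k\<close> times \<open>e T\<close> repairs the value at
      \<open>T\<close> and leaves those on \<open>\<tau>\<close> alone.\<close>
    have "interpolates n (insert T \<tau>) h (\<lambda>i. m i + ?k * e T i)"
      using e h T unfolding interpolates_def R_def
      by (auto simp: sum.distrib sum_distrib_left[symmetric])
    from divisor_eq[OF bal True this]
    have "divisor n h \<Delta> (insert T \<tau>) =
        (\<Sum>U\<in>R - {T}. (h U - (sum m U + ?k * sum (e T) U)) * W T U)"
      unfolding R_def W_def
      by (simp add: sum.distrib sum_distrib_left[symmetric] Diff_insert[symmetric] del: Diff_insert)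
    also have "\<dots> = (\<Sum>U\<in>R - {T}. (h U - sum m U) * W T U - ?k * (sum (e T) U * W T U))"
      by (intro sum.cong) (auto simp: algebra_simps)
    also have "\<dots> = (\<Sum>U\<in>R - {T}. (h U - sum m U) * W T U) - ?k * c T"
      unfolding c_def by (simp only: sum_subtractf sum_distrib_left)
    finally show ?thesis .
  next
    case False
    then have "\<not> cone n (insert U (insert T \<tau>))" for U using cone_subset by blast
    then have "W T U = 0" for U using bal by (simp add: balanced_def W_def)
    then show ?thesis using False by (simp add: divisor_def c_def)
  qed
  have full: "(\<Sum>T\<in>R. (k T - sum mk T) * divisor n h \<Delta> (insert T \<tau>)) =
      (\<Sum>T\<in>R. \<Sum>U\<in>R. if U = T then 0 else (k T - sum mk T) * (h U - sum mh U) * W T U)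
      - (\<Sum>T\<in>R. (k T - sum mk T) * (h T - sum mh T) * c T)"
    if h: "interpolates n \<tau> h mh" for h k :: "nat set \<Rightarrow> real" and mh mk
  proof -
    have "(k T - sum mk T) * divisor n h \<Delta> (insert T \<tau>) =
      (\<Sum>U\<in>R. if U = T then 0 else (k T - sum mk T) * (h U - sum mh U) * W T U)
      - (k T - sum mk T) * (h T - sum mh T) * c T" if T: "T \<in> R" for T
    proof -
      have "(\<Sum>U\<in>R. if U = T then 0 else (k T - sum mk T) * (h U - sum mh U) * W T U) =
        (\<Sum>U\<in>R - {T}. (k T - sum mk T) * ((h U - sum mh U) * W T U))"
        using finR by (intro sum.mono_neutral_cong_right) auto
      then show ?thesis unfolding expand[OF T h]
        by (simp add: right_diff_distrib sum_distrib_left mult.assoc)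
    qed
    then show ?thesis by (simp add: sum_subtractf)
  qed
  have "(\<Sum>T\<in>R. \<Sum>U\<in>R. if U = T then 0 else (g T - sum mg T) * (f U - sum mf U) * W T U) =
    (\<Sum>T\<in>R. \<Sum>U\<in>R. if U = T then 0 else (f T - sum mf T) * (g U - sum mg U) * W T U)"
    by (subst sum.swap) (intro sum.cong refl, auto simp: W_sym)
  then show ?thesis
    unfolding R_def[symmetric] full[OF f] full[OF g] by (simp add: mult.commute mult.left_commute)
qed

lemma divisor_zero: "balanced n \<Delta> \<Longrightarrow> divisor n (\<lambda>_. 0) \<Delta> = (\<lambda>_. 0)"
proof
  fix \<tau> assume bal: "balanced n \<Delta>"
  show "divisor n (\<lambda>_. 0) \<Delta> \<tau> = 0"
  proof (cases "cone n \<tau>")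
    case True
    then show ?thesis by (subst divisor_eq[OF bal True, of _ "\<lambda>_. 0"]) (auto simp: interpolates_def)
  qed (simp add: divisor_def)
qed

text \<open>The symmetry is applied to \<open>f\<close> and the zero function: \<open>m\<close>
  interpolates the latter, and its divisor is 0.\<close>

lemma balanced_divisor:
  assumes bal: "balanced n \<Delta>" shows "balanced n (divisor n f \<Delta>)"
  unfolding balanced_def
proof (intro conjI allI impI)
  fix \<tau> m assume \<tau>: "cone n \<tau>" and m: "interpolates n \<tau> (\<lambda>_. 0 :: real) m"
  obtain mf where "interpolates n \<tau> f mf" using cone_interpolation[OF \<tau>] by blast
  from divisor_symmetry[OF bal \<tau> this m]
  show "(\<Sum>T\<in>rays n - \<tau>. sum m T * divisor n f \<Delta> (insert T \<tau>)) = 0"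
    by (simp add: divisor_zero[OF bal] sum_negf)
qed (simp add: divisor_def)

lemma divisor_commute:
  assumes bal: "balanced n \<Delta>"
  shows "divisor n g (divisor n f \<Delta>) = divisor n f (divisor n g \<Delta>)"
proof
  fix \<tau>
  show "divisor n g (divisor n f \<Delta>) \<tau> = divisor n f (divisor n g \<Delta>) \<tau>"
  proof (cases "cone n \<tau>")
    case True
    obtain mf where f: "interpolates n \<tau> f mf" using cone_interpolation[OF True] by blast
    obtain mg where g: "interpolates n \<tau> g mg" using cone_interpolation[OF True] by blast
    show ?thesis
      unfolding divisor_eq[OF balanced_divisor[OF bal] True f] divisor_eq[OF balanced_divisor[OF bal] True g]
      by (rule divisor_symmetry[OF bal True f g])
  qed (simp add: divisor_def)
qed

text \<open>Unbalanced arguments are sent to 0, so that the operators commute on all functions.\<close>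

definition ray_op :: "nat \<Rightarrow> nat set \<Rightarrow> (nat set set \<Rightarrow> real) \<Rightarrow> nat set set \<Rightarrow> real" where
  "ray_op n T \<Delta> = (if balanced n \<Delta> then divisor n (\<lambda>U. if U = T then 1 else 0) \<Delta> else (\<lambda>_. 0))"

lemma balanced_0: "balanced n (\<lambda>_. 0)"
  by (simp add: balanced_def)

lemma balanced_ray_op: "balanced n (ray_op n T \<Delta>)"
  by (simp add: ray_op_def balanced_divisor balanced_0)

lemma divisor_0_right: "divisor n f (\<lambda>_. 0) = (\<lambda>_. 0)"
  by (auto simp: divisor_def Let_def)

text \<open>A monomial can now act through \<open>fold_mset\<close>, whatever the order of its
  factors.\<close>

interpretation ray_op: comp_fun_commute "ray_op n"
  by standard (auto simp: fun_eq_iff ray_op_def balanced_divisor balanced_0 divisor_0_right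
      divisor_commute)

lemma balanced_fold: "balanced n \<Delta> \<Longrightarrow> balanced n (fold_mset (ray_op n) \<Delta> A)"
  by (cases A) (auto simp: balanced_ray_op)

text \<open>The indicator of \<open>T\<close> vanishes on \<open>\<tau>\<close>, so 0 interpolates
  it there and only the summand at \<open>T\<close> remains.\<close>

lemma ray_op_new_ray:
  assumes bal: "balanced n \<Delta>" and T: "T \<notin> \<tau>"
  shows "ray_op n T \<Delta> \<tau> = \<Delta> (insert T \<tau>)"
proof (cases "cone n \<tau>")
  case True
  have "interpolates n \<tau> (\<lambda>U. if U = T then 1 else 0 :: real) (\<lambda>_. 0)"
    using T by (auto simp: interpolates_def)
  from divisor_eq[OF bal True this]
  have "ray_op n T \<Delta> \<tau> = (\<Sum>U\<in>rays n - \<tau>. (if U = T then 1 else 0) * \<Delta> (insert U \<tau>))"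
    using bal by (simp add: ray_op_def)
  also have "\<dots> = (if T \<in> rays n then \<Delta> (insert T \<tau>) else 0)"
    using T finite_rays by (simp add: if_distrib[of "\<lambda>x. x * _"] cong: if_cong)
  also have "\<dots> = \<Delta> (insert T \<tau>)"
    using bal by (auto simp: balanced_def cone_def)
  finally show ?thesis .
next
  case False
  then have "\<not> cone n (insert T \<tau>)" using cone_subset by blast
  then show ?thesis using False bal by (simp add: ray_op_def divisor_def balanced_def)
qed

lemma fold_ray_op_squarefree:
  assumes "finite C" "balanced n \<Delta>" "C \<inter> \<tau> = {}"
  shows "fold_mset (ray_op n) \<Delta> (mset_set C) \<tau> = \<Delta> (C \<union> \<tau>)"
  using assms(1,3)
proof (induction C arbitrary: \<tau> rule: finite_induct)
  case (insert T C)
  have "fold_mset (ray_op n) \<Delta> (mset_set C) (insert T \<tau>) = \<Delta> (C \<union> insert T \<tau>)"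
    using insert.hyps insert.prems by (intro insert.IH) auto
  then show ?case
    using insert.hyps insert.prems ray_op_new_ray[OF balanced_fold[OF assms(2)]] by simp
qed simp

section \<open>The functional on polynomials attached to a weight\<close>

definition exponents :: "(nat set \<Rightarrow>\<^sub>0 nat) \<Rightarrow> nat set multiset" where
  "exponents s = Abs_multiset (Poly_Mapping.lookup s)"

lemma count_exponents: "count (exponents s) = Poly_Mapping.lookup s"
  unfolding exponents_def by (rule count_Abs_multiset) (use finite_lookup[of s] in simp)

lemma exponents_add: "exponents (s + t) = exponents s + exponents t"
  by (rule multiset_eqI) (simp add: count_exponents lookup_add)

lemma exponents_0: "exponents 0 = {#}"
  by (rule multiset_eqI) (simp add: count_exponents)

lemma exponents_single: "exponents (Poly_Mapping.single T 1) = {#T#}"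
  by (rule multiset_eqI) (simp add: count_exponents lookup_single when_def)

text \<open>The functional on the Chow ring, lifted to polynomials: each monomial acts on the weight
  by divisors, and the result is read off at the zero cone \<open>{}\<close>.\<close>

definition functional :: "nat \<Rightarrow> (nat set set \<Rightarrow> real) \<Rightarrow> poly \<Rightarrow> real" where
  "functional n \<Delta> p =
    (\<Sum>s\<in>Poly_Mapping.keys p. Poly_Mapping.lookup p s * fold_mset (ray_op n) \<Delta> (exponents s) {})"

lemma functional_eq:
  assumes "finite A" "Poly_Mapping.keys p \<subseteq> A"
  shows "functional n \<Delta> p =
    (\<Sum>s\<in>A. Poly_Mapping.lookup p s * fold_mset (ray_op n) \<Delta> (exponents s) {})"
  unfolding functional_def using assms
  by (intro sum.mono_neutral_left) (auto simp: in_keys_iff)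

lemma functional_add: "functional n \<Delta> (p + q) = functional n \<Delta> p + functional n \<Delta> q"
proof -
  let ?A = "Poly_Mapping.keys p \<union> Poly_Mapping.keys q"
  have "Poly_Mapping.keys (p + q) \<subseteq> ?A" by (rule Poly_Mapping.keys_add)
  then show ?thesis
    by (simp add: functional_eq[of ?A] lookup_add distrib_right sum.distrib)
qed

lemma functional_0: "functional n \<Delta> 0 = 0"
  by (simp add: functional_def)

lemma functional_diff: "functional n \<Delta> (p - q) = functional n \<Delta> p - functional n \<Delta> q"
  using functional_add[of n \<Delta> "p - q" q] by simp

lemma functional_sum: "functional n \<Delta> (\<Sum>x\<in>A. f x) = (\<Sum>x\<in>A. functional n \<Delta> (f x))"
  by (induction A rule: infinite_finite_induct) (auto simp: functional_add functional_0)

lemma functional_single: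
  "functional n \<Delta> (Poly_Mapping.single s c) = c * fold_mset (ray_op n) \<Delta> (exponents s) {}"
  by (subst functional_eq[of "{s}"]) auto

lemma mono_eq_single:
  assumes "finite C"
  shows "mono C = Poly_Mapping.single (\<Sum>T\<in>C. Poly_Mapping.single T 1) 1"
  unfolding mono_def using assms
  by (induction C rule: finite_induct) (auto simp: var_def mult_single simp flip: single_one)

lemma exponents_sum:
  assumes "finite C"
  shows "exponents (\<Sum>T\<in>C. Poly_Mapping.single T 1) = mset_set C"
  using assms by (induction C rule: finite_induct) (auto simp: exponents_0 exponents_add exponents_single simp del: One_nat_def)

text \<open>The squarefree factor is applied last and moves the evaluation from \<open>{}\<close> to
  \<open>C\<close>.\<close>

lemma functional_single_mono:
  assumes "balanced n \<Delta>" "finite C"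
  shows "functional n \<Delta> (Poly_Mapping.single s c * mono C) =
    c * fold_mset (ray_op n) \<Delta> (exponents s) C"
proof -
  have "functional n \<Delta> (Poly_Mapping.single s c * mono C) =
      c * fold_mset (ray_op n) \<Delta> (exponents s + mset_set C) {}"
    using assms(2) by (simp add: mono_eq_single mult_single functional_single exponents_add exponents_sum
        del: ray_op.fold_mset_union One_nat_def)
  also have "\<dots> = c * fold_mset (ray_op n) \<Delta> (exponents s) C"
    using fold_ray_op_squarefree[OF assms(2) balanced_fold[OF assms(1)], of "{}"] by simp
  finally show ?thesis .
qed

lemma poly_eq_sum_single:
  fixes p :: "'a \<Rightarrow>\<^sub>0 'b::comm_monoid_add"
  shows "p = (\<Sum>s\<in>Poly_Mapping.keys p. Poly_Mapping.single s (Poly_Mapping.lookup p s))"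
proof (rule poly_mapping_eqI)
  fix k
  show "Poly_Mapping.lookup p k = Poly_Mapping.lookup (\<Sum>s\<in>Poly_Mapping.keys p.
    Poly_Mapping.single s (Poly_Mapping.lookup p s)) k"
    by (simp add: lookup_sum lookup_single when_def in_keys_iff)
qed

text \<open>By linearity the cofactor may be a monomial, whose action turns \<open>\<Delta>\<close>
  into another balanced weight. For that weight a non-face gives a value off the fan, and a linear
  generator gives the balancing sum at \<open>{}\<close>.\<close>

lemma functional_chow_ideal:
  assumes bal: "balanced n \<Delta>" and p: "p \<in> chow_ideal n"
  shows "functional n \<Delta> p = 0"
proof -
  have reduce: "functional n \<Delta> (q * g) = 0"
    if "\<And>s c. functional n \<Delta> (Poly_Mapping.single s c * g) = 0" for q g
  proof -
    have "q * g = (\<Sum>s\<in>Poly_Mapping.keys q. Poly_Mapping.single s (Poly_Mapping.lookup q s) * g)"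
      by (subst poly_eq_sum_single[of q]) (rule sum_distrib_right)
    then show ?thesis using that by (simp add: functional_sum)
  qed
  have nonface: "functional n \<Delta> (q * mono C) = 0" if "C \<subseteq> rays n" "\<not> is_chain C" for q C
  proof (rule reduce)
    fix s c
    have "finite C" using that finite_rays finite_subset by blast
    moreover have "fold_mset (ray_op n) \<Delta> (exponents s) C = 0"
      using balanced_fold[OF bal, of "exponents s"] that(2) by (simp add: balanced_def cone_def)
    ultimately show "functional n \<Delta> (Poly_Mapping.single s c * mono C) = 0"
      using functional_single_mono[OF bal] by simp
  qed
  have linear: "functional n \<Delta> (q * (\<Sum>T\<in>rays n. of_int (\<Sum>i\<in>T. m i) * var T)) = 0"
    if "(\<Sum>i\<in>{0..n}. m i) = 0" for q and m :: "nat \<Rightarrow> int"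
  proof (rule reduce)
    fix s c
    let ?\<Delta> = "fold_mset (ray_op n) \<Delta> (exponents s)"
    have monom: "functional n \<Delta> (Poly_Mapping.single s c * (of_int k * var T)) = c * (of_int k * ?\<Delta> {T})"
      for k T
    proof -
      have "Poly_Mapping.single s c * (of_int k * var T) = Poly_Mapping.single s (c * of_int k) * mono {T}"
        by (simp add: mono_def mult_single mult.assoc[symmetric] flip: single_of_int)
      then show ?thesis using functional_single_mono[OF bal, of "{T}"] by simp
    qed
    have "interpolates n {} (\<lambda>_. 0) (\<lambda>i. real_of_int (m i))"
      using that by (simp add: interpolates_def flip: of_int_sum)
    moreover have "cone n {}" by (simp add: cone_def is_chain_def)
    ultimately have "(\<Sum>T\<in>rays n. sum (\<lambda>i. real_of_int (m i)) T * ?\<Delta> {T}) = 0"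
      using balanced_fold[OF bal, of "exponents s"] unfolding balanced_def by fastforce
    then show "functional n \<Delta> (Poly_Mapping.single s c * (\<Sum>T\<in>rays n. of_int (\<Sum>i\<in>T. m i) * var T)) = 0"
      unfolding sum_distrib_left functional_sum monom by (simp add: sum_distrib_left[symmetric])
  qed
  show ?thesis
    using p unfolding chow_ideal_def
  proof (induction p rule: ideal_gen.induct)
    case (gen g q)
    then show ?case using nonface linear by blast
  qed (simp_all add: functional_0 functional_add)
qed

section \<open>The degree functional and the cap product with a divisor class\<close>

text \<open>\<open>functional\<close> kills the ideal and has value \<open>\<Delta> \<sigma>\<close>
  at the monomial of an \<open>l\<close>-dimensional cone \<open>\<sigma>\<close>. Hence all
  expansions of \<open>p\<close> give the same number, and the definite description in
  \<open>deg_fun\<close> denotes it.\<close>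

lemma deg_fun_eq:
  assumes bal: "balanced n (\<lambda>\<sigma>. if \<sigma> \<in> cones n l then \<Delta> \<sigma> else 0)"
    and a: "p - (\<Sum>\<sigma>\<in>cones n l. Poly_Mapping.single 0 (a \<sigma>) * mono \<sigma>) \<in> chow_ideal n"
  shows "deg_fun n l \<Delta> p = (\<Sum>\<sigma>\<in>cones n l. a \<sigma> * \<Delta> \<sigma>)"
proof -
  let ?\<phi> = "functional n (\<lambda>\<sigma>. if \<sigma> \<in> cones n l then \<Delta> \<sigma> else 0)"
  have value_a: "?\<phi> p = (\<Sum>\<sigma>\<in>cones n l. b \<sigma> * \<Delta> \<sigma>)"
    if "p - (\<Sum>\<sigma>\<in>cones n l. Poly_Mapping.single 0 (b \<sigma>) * mono \<sigma>) \<in> chow_ideal n" for b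
  proof -
    have "finite \<sigma>" if "\<sigma> \<in> cones n l" for \<sigma>
      using that finite_rays finite_subset by (auto simp: cones_def)
    then show ?thesis
      using functional_chow_ideal[OF bal that]
      by (simp add: functional_diff functional_sum functional_single_mono[OF bal] exponents_0)
  qed
  show ?thesis
    unfolding deg_fun_def
  proof (rule the_equality)
    show "\<exists>b. p - (\<Sum>\<sigma>\<in>cones n l. Poly_Mapping.single 0 (b \<sigma>) * mono \<sigma>) \<in> chow_ideal n \<and>
        (\<Sum>\<sigma>\<in>cones n l. a \<sigma> * \<Delta> \<sigma>) = (\<Sum>\<sigma>\<in>cones n l. b \<sigma> * \<Delta> \<sigma>)"
      using a by blast
  next
    fix c
    assume "\<exists>b. p - (\<Sum>\<sigma>\<in>cones n l. Poly_Mapping.single 0 (b \<sigma>) * mono \<sigma>) \<in> chow_ideal n \<and>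
        c = (\<Sum>\<sigma>\<in>cones n l. b \<sigma> * \<Delta> \<sigma>)"
    then obtain b where b: "p - (\<Sum>\<sigma>\<in>cones n l. Poly_Mapping.single 0 (b \<sigma>) * mono \<sigma>) \<in> chow_ideal n"
      "c = (\<Sum>\<sigma>\<in>cones n l. b \<sigma> * \<Delta> \<sigma>)" by blast
    show "c = (\<Sum>\<sigma>\<in>cones n l. a \<sigma> * \<Delta> \<sigma>)"
      using value_a[OF a] value_a[OF b(1)] b(2) by simp
  qed
qed

lemma ideal_gen_sum:
  assumes "\<And>x. x \<in> A \<Longrightarrow> f x \<in> ideal_gen G" shows "sum f A \<in> ideal_gen G"
  using assms by (induction A rule: infinite_finite_induct) (auto intro: ideal_gen.intros)

text \<open>Subtracting the linear generator of \<open>m\<close> removes the rays of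
  \<open>\<sigma>\<close>, and rays not comparable with \<open>\<sigma>\<close> give non-faces.
  Modulo the ideal only squarefree monomials of \<open>l\<close>-dimensional cones remain.
  \<open>m\<close> has to be integral because the generators are.\<close>

lemma cap_eq:
  fixes f :: "nat set \<Rightarrow> int"
  assumes bal: "balanced n (\<lambda>\<sigma>. if \<sigma> \<in> cones n l then \<Delta> \<sigma> else 0)"
    and \<sigma>: "\<sigma> \<in> cones n (l - 1)" "l \<ge> 1"
    and m: "interpolates n \<sigma> f m"
  shows "cap n l (\<Sum>T\<in>rays n. of_int (f T) * var T) \<Delta> \<sigma> =
    (\<Sum>T | T \<in> rays n - \<sigma> \<and> is_chain (insert T \<sigma>). of_int (f T - sum m T) * \<Delta> (insert T \<sigma>))"
proof -
  define K where "K = {T. T \<in> rays n - \<sigma> \<and> is_chain (insert T \<sigma>)}"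
  define w where "w = (\<lambda>T. f T - sum m T)"
  \<comment> \<open>Coefficients are collected by the resulting cone, the shape that
    \<open>deg_fun\<close> asks for; \<open>sum.group\<close> undoes this.\<close>
  define a where "a = (\<lambda>\<sigma>'. \<Sum>T | T \<in> K \<and> insert T \<sigma> = \<sigma>'. real_of_int (w T))"
  define \<xi> where "\<xi> = (\<Sum>T\<in>rays n. of_int (f T) * var T)"
  have \<sigma>': "\<sigma> \<subseteq> rays n" "card \<sigma> = l - 1" using \<sigma> by (auto simp: cones_def)
  then have fin: "finite \<sigma>" "finite K" "finite (cones n l)"
    using finite_rays by (auto simp: K_def cones_def intro: finite_subset[of _ "Pow (rays n)"] finite_subset)
  have K_cones: "(\<lambda>T. insert T \<sigma>) ` K \<subseteq> cones n l"
    using \<sigma>' \<sigma>(2) fin by (auto simp: K_def cones_def)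
  have mono_insert: "mono (insert T \<sigma>) = var T * mono \<sigma>" if "T \<notin> \<sigma>" for T
    using that fin by (simp add: mono_def)
  have "(\<Sum>\<sigma>'\<in>cones n l. Poly_Mapping.single 0 (a \<sigma>') * mono \<sigma>') =
      (\<Sum>\<sigma>'\<in>cones n l. \<Sum>T | T \<in> K \<and> insert T \<sigma> = \<sigma>'. of_int (w T) * mono (insert T \<sigma>))"
  proof (rule sum.cong[OF refl])
    fix \<sigma>'
    have "Poly_Mapping.single 0 (a \<sigma>') = (\<Sum>T | T \<in> K \<and> insert T \<sigma> = \<sigma>'. of_int (w T) :: poly)"
      unfolding a_def by (simp add: single_of_int flip: of_int_sum)
    then show "Poly_Mapping.single 0 (a \<sigma>') * mono \<sigma>' =
        (\<Sum>T | T \<in> K \<and> insert T \<sigma> = \<sigma>'. of_int (w T) * mono (insert T \<sigma>))"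
      by (simp add: sum_distrib_right)
  qed
  also have "\<dots> = (\<Sum>T\<in>K. of_int (w T) * mono (insert T \<sigma>))"
    by (rule sum.group[OF fin(2,3) K_cones])
  finally have target: "(\<Sum>\<sigma>'\<in>cones n l. Poly_Mapping.single 0 (a \<sigma>') * mono \<sigma>') =
      (\<Sum>T\<in>K. of_int (w T) * var T * mono \<sigma>)"
    using mono_insert by (simp add: K_def mult.assoc)
  have w_0: "w T = 0" if "T \<in> \<sigma>" for T using m that by (simp add: w_def interpolates_def)
  have "\<xi> * mono \<sigma> = (\<Sum>T\<in>rays n. of_int (sum m T) * var T) * mono \<sigma>
      + (\<Sum>T\<in>rays n. of_int (w T) * var T * mono \<sigma>)"
    unfolding \<xi>_def sum_distrib_right sum.distrib[symmetric]
    by (intro sum.cong) (auto simp: w_def algebra_simps)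
  also have "(\<Sum>T\<in>rays n. of_int (w T) * var T * mono \<sigma>) =
      (\<Sum>T\<in>rays n - \<sigma>. of_int (w T) * var T * mono \<sigma>)"
    using finite_rays w_0 by (intro sum.mono_neutral_right) auto
  also have "\<dots> = (\<Sum>T\<in>K. of_int (w T) * var T * mono \<sigma>) +
      (\<Sum>T\<in>rays n - \<sigma> - K. of_int (w T) * var T * mono \<sigma>)"
    using finite_rays by (subst add.commute, intro sum.subset_diff) (auto simp: K_def)
  finally have "\<xi> * mono \<sigma> - (\<Sum>\<sigma>'\<in>cones n l. Poly_Mapping.single 0 (a \<sigma>') * mono \<sigma>') =
      mono \<sigma> * (\<Sum>T\<in>rays n. of_int (sum m T) * var T) +
      (\<Sum>T\<in>rays n - \<sigma> - K. of_int (w T) * mono (insert T \<sigma>))"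
    unfolding target by (simp add: mono_insert mult_ac)
  also have "\<dots> \<in> chow_ideal n"
    unfolding chow_ideal_def
  proof (intro ideal_gen.add ideal_gen_sum ideal_gen.gen)
    show "(\<Sum>T\<in>rays n. of_int (sum m T) * var T) \<in> {mono C |C. C \<subseteq> rays n \<and> \<not> is_chain C} \<union>
        {\<Sum>T\<in>rays n. of_int (sum m T) * var T |m. sum m {0..n} = 0}"
      using m by (auto simp: interpolates_def)
    show "mono (insert T \<sigma>) \<in> {mono C |C. C \<subseteq> rays n \<and> \<not> is_chain C} \<union>
        {\<Sum>T\<in>rays n. of_int (sum m T) * var T |m. sum m {0..n} = 0}" if "T \<in> rays n - \<sigma> - K" for T
      using that \<sigma>' by (auto simp: K_def)
  qed
  finally have "cap n l \<xi> \<Delta> \<sigma> = (\<Sum>\<sigma>'\<in>cones n l. a \<sigma>' * \<Delta> \<sigma>')"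
    unfolding cap_def by (rule deg_fun_eq[OF bal])
  also have "\<dots> = (\<Sum>\<sigma>'\<in>cones n l. \<Sum>T | T \<in> K \<and> insert T \<sigma> = \<sigma>'. of_int (w T) * \<Delta> (insert T \<sigma>))"
    unfolding a_def by (intro sum.cong refl) (simp add: sum_distrib_right)
  also have "\<dots> = (\<Sum>T\<in>K. of_int (w T) * \<Delta> (insert T \<sigma>))"
    by (rule sum.group[OF fin(2,3) K_cones])
  finally show ?thesis unfolding \<xi>_def w_def K_def .
qed

text \<open>The values of the piecewise linear function of \<open>h_S\<close>, in the form that
  \<open>cap_eq\<close> takes.\<close>

lemma h_div_eq:
  "h_div n S = (\<Sum>T\<in>rays n. of_int ((if 0 \<in> T then 1 else 0) - (if S \<subseteq> T then 1 else 0)) * var T)"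
proof -
  have "(\<Sum>T | T \<in> rays n \<and> P T. var T) = (\<Sum>T\<in>rays n. of_int (if P T then 1 else 0) * var T)" for P
    using finite_rays by (simp add: sum.inter_filter if_distrib[of of_int] if_distrib[of "\<lambda>x. x * _"] cong: if_cong)
  then show ?thesis
    unfolding h_div_def alpha_def by (simp add: left_diff_distrib sum_subtractf)
qed

subsection \<open>Bergman classes\<close>

context matroid
begin

definition between :: "'a set \<Rightarrow> 'a set \<Rightarrow> 'a set set" where
  "between G H = {T. is_flat E \<B> T \<and> G \<subset> T \<and> T \<subset> H}"

lemma finite_between: "finite (between G H)"
  by (rule finite_subset[of _ "Pow E"]) (auto simp: between_def is_flat_def finite_ground)

lemma between_unique:
  assumes "is_flat E \<B> G" "is_flat E \<B> H" "G \<subseteq> H" "r H = r G + 2" "e \<in> H - G"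
  shows "T \<in> between G H \<and> e \<in> T \<longleftrightarrow> T = cl (insert e G)"
  unfolding flat_between[OF assms, symmetric] by (simp add: between_def conj_assoc)

text \<open>The sets T - G, for T strictly between G and H, partition H - G.\<close>

lemma sum_between:
  fixes m :: "'a \<Rightarrow> 'b::comm_ring_1"
  assumes G: "is_flat E \<B> G" and H: "is_flat E \<B> H" and GH: "G \<subseteq> H" "r H = r G + 2"
  shows "(\<Sum>T\<in>between G H. sum m T) =
    of_nat (card (between G H)) * sum m G + (sum m H - sum m G)"
proof -
  have fin: "finite H" using H finite_ground finite_subset by (auto simp: is_flat_def)
  have sub: "finite T" "G \<subseteq> T" "T \<subseteq> H" if "T \<in> between G H" for T
    using that fin finite_subset by (auto simp: between_def)
  have cover: "T \<in> between G H \<and> e \<in> T \<longleftrightarrow> T = cl (insert e G)" if "e \<in> H - G" for e T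
    by (rule between_unique[OF G H GH that])
  have union: "(\<Union>T\<in>between G H. T - G) = H - G"
  proof (rule subset_antisym; rule subsetI)
    show "e \<in> H - G" if "e \<in> (\<Union>T\<in>between G H. T - G)" for e using that sub(3) by blast
    show "e \<in> (\<Union>T\<in>between G H. T - G)" if "e \<in> H - G" for e
      using cover[OF that, of "cl (insert e G)"] that by blast
  qed
  have disjoint: "(T - G) \<inter> (U - G) = {}" if "T \<in> between G H" "U \<in> between G H" "T \<noteq> U" for T U
  proof (rule ccontr)
    assume "(T - G) \<inter> (U - G) \<noteq> {}"
    then obtain e where e: "e \<in> T" "e \<in> U" "e \<notin> G" by blast
    then have "e \<in> H - G" using sub(3)[OF that(1)] by blast
    then show False using cover[of e T] cover[of e U] e that by blast
  qed
  have "(\<Sum>T\<in>between G H. sum m T) = (\<Sum>T\<in>between G H. sum m G + sum m (T - G))"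
  proof (rule sum.cong[OF refl])
    fix T assume "T \<in> between G H"
    then show "sum m T = sum m G + sum m (T - G)"
      using sum.subset_diff[OF sub(2,1)[of T], of m] by (simp add: add.commute)
  qed
  also have "\<dots> = of_nat (card (between G H)) * sum m G + sum m (H - G)"
  proof -
    have "sum m (H - G) = (\<Sum>T\<in>between G H. sum m (T - G))"
      unfolding union[symmetric]
      by (rule sum.UNION_disjoint) (use finite_between sub(1) disjoint in auto)
    then show ?thesis by (simp add: sum.distrib)
  qed
  also have "sum m (H - G) = sum m H - sum m G"
    using sum_diff[OF fin GH(1)] by blast
  finally show ?thesis .
qed

text \<open>An element of \<open>S\<close> outside \<open>G\<close> lies in at most one block
  \<open>T - G\<close>, so at most one \<open>T\<close> contains \<open>S\<close> unless
  \<open>S \<subseteq> G\<close>.\<close>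

lemma count_between:
  assumes G: "is_flat E \<B> G" and H: "is_flat E \<B> H" and GH: "G \<subseteq> H" "r H = r G + 2"
  shows "(\<Sum>T\<in>between G H. if S \<subseteq> T then 1 else 0 :: int) =
    (if S \<subseteq> G then int (card (between G H)) else if \<exists>T\<in>between G H. S \<subseteq> T then 1 else 0)"
proof (cases "S \<subseteq> G")
  case True
  then have "(\<Sum>T\<in>between G H. if S \<subseteq> T then 1 else 0 :: int) = (\<Sum>T\<in>between G H. 1)"
    by (intro sum.cong) (auto simp: between_def)
  then show ?thesis using True by simp
next
  case False
  show ?thesis
  proof (cases "\<exists>T\<in>between G H. S \<subseteq> T")
    case True
    then obtain T where T: "T \<in> between G H" "S \<subseteq> T" by blast
    obtain s where s: "s \<in> S" "s \<notin> G" using False by blast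
    then have sH: "s \<in> H - G" using T by (auto simp: between_def)
    have "U = T" if "S \<subseteq> U" "U \<in> between G H" for U
      using between_unique[OF G H GH sH, of T] between_unique[OF G H GH sH, of U] T that s(1)
      by (metis subsetD)
    then have "S \<subseteq> U \<longleftrightarrow> U = T" if "U \<in> between G H" for U
      using that T(2) by blast
    then have "(\<Sum>U\<in>between G H. if S \<subseteq> U then 1 else 0 :: int) =
        (\<Sum>U\<in>between G H. if U = T then 1 else 0)"
      by (intro sum.cong refl) simp
    then show ?thesis using True False T finite_between by simp
  qed (use False in \<open>auto intro!: sum.neutral\<close>)
qed

end

section \<open>Flags of flats and balancing of the Bergman class\<close>

locale braid_matroid = loopless_matroid "{0..n}" \<B> for n and \<B> :: "nat set set" +
  fixes d assumes rank_d: "mrank \<B> {0..n} = Suc d" and d_pos: "d \<ge> 1"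
begin

text \<open>The two improper flats, of ranks 0 and \<open>Suc d\<close>, are added in
  \<open>full\<close> so that a gap at an end of the flag is treated like any other.\<close>

abbreviation flat :: "nat set \<Rightarrow> bool" where "flat \<equiv> is_flat {0..n} \<B>"

abbreviation full :: "nat set set \<Rightarrow> nat set set" where "full \<sigma> \<equiv> insert {} (insert {0..n} \<sigma>)"

lemma full_flat: "\<forall>T\<in>\<sigma>. flat T \<Longrightarrow> X \<in> full \<sigma> \<Longrightarrow> flat X"
  using empty_flat ground_flat by blast

lemma flat_rank_cmp:
  assumes "flat X" "flat Y" "X \<subseteq> Y \<or> Y \<subseteq> X"
  shows "X \<subseteq> Y \<longleftrightarrow> r X \<le> r Y" "r X = r Y \<longleftrightarrow> X = Y"
proof -
  have sub: "X \<subseteq> {0..n}" "Y \<subseteq> {0..n}" using assms(1,2) by (auto simp: is_flat_def)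
  consider "X = Y" | "X \<subset> Y" | "Y \<subset> X" using assms(3) by blast
  then have "(X \<subseteq> Y \<longleftrightarrow> r X \<le> r Y) \<and> (r X = r Y \<longleftrightarrow> X = Y)"
  proof cases
    case 2
    then show ?thesis using flat_rank_less[OF assms(1) 2 sub(2)] by auto
  next
    case 3
    then show ?thesis using flat_rank_less[OF assms(2) 3 sub(1)] by auto
  qed simp
  then show "X \<subseteq> Y \<longleftrightarrow> r X \<le> r Y" "r X = r Y \<longleftrightarrow> X = Y" by blast+
qed

text \<open>A flag of d - 1 proper flats misses exactly one rank, say k; G and H are its members of
  rank k - 1 and k + 1, where the empty set and the ground set count as members.\<close>

lemma flag_gap:
  assumes \<sigma>: "\<sigma> \<in> cones n (d - 1)" and flats: "\<forall>T\<in>\<sigma>. flat T"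
  obtains G H where "G \<in> full \<sigma>" "H \<in> full \<sigma>" "r H = r G + 2" "G \<subseteq> H"
    "r ` full \<sigma> = {0..Suc d} - {Suc (r G)}" "\<And>X. X \<in> full \<sigma> \<Longrightarrow> X \<subseteq> G \<or> H \<subseteq> X"
proof -
  have \<sigma>': "\<sigma> \<subseteq> rays n" "is_chain \<sigma>" "card \<sigma> = d - 1" using \<sigma> by (auto simp: cones_def)
  have fin: "finite \<sigma>" using \<sigma>'(1) finite_rays finite_subset by blast
  have chain: "X \<subseteq> Y \<or> Y \<subseteq> X" if "X \<in> full \<sigma>" "Y \<in> full \<sigma>" for X Y
    using that \<sigma>' unfolding is_chain_def rays_def by fast
  have cmp: "X \<subseteq> Y \<longleftrightarrow> r X \<le> r Y" "r X = r Y \<longleftrightarrow> X = Y" if "X \<in> full \<sigma>" "Y \<in> full \<sigma>" for X Y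
    using flat_rank_cmp[OF full_flat[OF flats that(1)] full_flat[OF flats that(2)] chain[OF that]]
    by blast+
  have "{0..n} \<notin> \<sigma>" "{} \<notin> insert {0..n} \<sigma>" using \<sigma>'(1) by (auto simp: rays_def)
  \<comment> \<open>The \<open>d - 1\<close> flats and the two improper ones have
    \<open>d + 1\<close> distinct ranks among the \<open>d + 2\<close> values up to
    \<open>Suc d\<close>, so exactly one value is missed.\<close>
  then have "card (full \<sigma>) = Suc d" using \<sigma>'(3) fin d_pos by simp
  moreover have "inj_on r (full \<sigma>)" using cmp(2) by (simp add: inj_on_def)
  ultimately have card_image: "card (r ` full \<sigma>) = Suc d" by (simp only: card_image)
  have sub: "r ` full \<sigma> \<subseteq> {0..Suc d}"
  proof (rule image_subsetI)
    fix X assume "X \<in> full \<sigma>"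
    then have "X \<subseteq> {0..n}" using full_flat[OF flats] by (simp add: is_flat_def)
    then show "r X \<in> {0..Suc d}" using rank_mono[of X "{0..n}"] rank_d by simp
  qed
  then have "card ({0..Suc d} - r ` full \<sigma>) = 1"
    using card_image by (subst card_Diff_subset) (auto intro: finite_subset)
  then obtain k where k: "{0..Suc d} - r ` full \<sigma> = {k}" by (rule card_1_singletonE)
  have image: "r ` full \<sigma> = {0..Suc d} - {k}" using k sub by blast
  have ne: "r X \<noteq> k" if "X \<in> full \<sigma>" for X
    using imageI[OF that, of r] unfolding image by simp
  have "k \<noteq> 0" "k \<noteq> Suc d" using ne[of "{}"] ne[of "{0..n}"] rank_empty rank_d by simp_all
  moreover have "k \<in> {0..Suc d}" using k by blast
  ultimately have "k - 1 \<in> r ` full \<sigma>" "Suc k \<in> r ` full \<sigma>" unfolding image by auto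
  then obtain G H where G: "k - 1 = r G" "G \<in> full \<sigma>" and H: "Suc k = r H" "H \<in> full \<sigma>"
    by (elim imageE)
  have kG: "k = Suc (r G)" using G \<open>k \<noteq> 0\<close> by simp
  show thesis
  proof (rule that[OF G(2) H(2)])
    show "r H = r G + 2" using H kG by simp
    show "G \<subseteq> H" using cmp(1)[OF G(2) H(2)] H kG by simp
    show "r ` full \<sigma> = {0..Suc d} - {Suc (r G)}" using image kG by simp
    fix X assume X: "X \<in> full \<sigma>"
    show "X \<subseteq> G \<or> H \<subseteq> X" using ne[OF X] cmp(1)[OF X G(2)] cmp(1)[OF H(2) X] H kG by linarith
  qed
qed

text \<open>Comparable flats are ordered and separated by rank, so a new flat comparable with the
  flag must have the missing rank. Conversely every member lies below \<open>G\<close> or above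
  \<open>H\<close>, so all that lies between them is comparable with the flag.\<close>

lemma flag_extensions:
  assumes \<sigma>: "\<sigma> \<in> cones n (d - 1)" and flats: "\<forall>T\<in>\<sigma>. flat T"
    and GH: "G \<in> full \<sigma>" "H \<in> full \<sigma>" "r H = r G + 2" "G \<subseteq> H"
      "r ` full \<sigma> = {0..Suc d} - {Suc (r G)}" "\<And>X. X \<in> full \<sigma> \<Longrightarrow> X \<subseteq> G \<or> H \<subseteq> X"
  shows "{T \<in> rays n - \<sigma>. is_chain (insert T \<sigma>) \<and> flat T} = between G H"
proof (rule subset_antisym; rule subsetI)
  fix T assume "T \<in> {T \<in> rays n - \<sigma>. is_chain (insert T \<sigma>) \<and> flat T}"
  then have T: "T \<in> rays n" "T \<notin> \<sigma>" "is_chain (insert T \<sigma>)" "flat T" by auto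
  have cmp: "T \<subseteq> X \<longleftrightarrow> r T \<le> r X" "X \<subseteq> T \<longleftrightarrow> r X \<le> r T" "r T = r X \<longleftrightarrow> T = X" if X: "X \<in> full \<sigma>" for X
  proof -
    have "T \<subseteq> {0..n}" using T(4) by (simp add: is_flat_def)
    then have TX: "T \<subseteq> X \<or> X \<subseteq> T" using X T(3) by (auto simp: is_chain_def)
    show "T \<subseteq> X \<longleftrightarrow> r T \<le> r X" "r T = r X \<longleftrightarrow> T = X"
      by (rule flat_rank_cmp[OF T(4) full_flat[OF flats X] TX])+
    show "X \<subseteq> T \<longleftrightarrow> r X \<le> r T"
      by (rule flat_rank_cmp[OF full_flat[OF flats X] T(4)]) (use TX in blast)
  qed
  have "T \<notin> full \<sigma>" using T(1,2) by (auto simp: rays_def)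
  then have "r T \<notin> r ` full \<sigma>" using cmp(3) by blast
  moreover have "r T \<le> Suc d" using T(1) rank_mono[of T "{0..n}"] rank_d by (auto simp: rays_def)
  ultimately have "r T = Suc (r G)" using GH(5) by auto
  then show "T \<in> between G H"
    using T(4) cmp(2)[OF GH(1)] cmp(1)[OF GH(2)] cmp(3)[OF GH(1)] cmp(3)[OF GH(2)] GH(3)
    unfolding between_def by auto
next
  fix T assume "T \<in> between G H"
  then have T: "flat T" "G \<subset> T" "T \<subset> H" by (auto simp: between_def)
  have "H \<subseteq> {0..n}" using full_flat[OF flats GH(2)] by (simp add: is_flat_def)
  then have "T \<in> rays n" using T by (auto simp: rays_def)
  moreover have "T \<notin> \<sigma>" using T GH(6)[of T] by blast
  moreover have "T \<subseteq> X \<or> X \<subseteq> T" if "X \<in> \<sigma>" for X using T GH(6)[of X] that by blast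
  then have "is_chain (insert T \<sigma>)" using \<sigma> unfolding is_chain_def cones_def by auto
  ultimately show "T \<in> {T \<in> rays n - \<sigma>. is_chain (insert T \<sigma>) \<and> flat T}" using T by blast
qed

lemma sum_bergman:
  assumes "\<forall>T\<in>\<sigma>. flat T"
  shows "(\<Sum>T | T \<in> rays n - \<sigma> \<and> is_chain (insert T \<sigma>). w T * bergman n \<B> (insert T \<sigma>)) =
    sum w {T \<in> rays n - \<sigma>. is_chain (insert T \<sigma>) \<and> flat T}"
  using assms finite_rays
  by (intro sum.mono_neutral_cong_right) (auto simp: bergman_def)

text \<open>Only flags of \<open>d - 1\<close> flats matter. There \<open>m\<close> sums to 0 over
  \<open>G\<close> and over \<open>H\<close>, so the partition formula \<open>sum_between\<close>
  gives 0.\<close>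

lemma balanced_bergman:
  "balanced n (\<lambda>\<sigma>. if \<sigma> \<in> cones n d then bergman n \<B> \<sigma> else 0)"
  unfolding balanced_def
proof (intro conjI allI impI)
  fix \<tau> assume "\<not> cone n \<tau>"
  then show "(if \<tau> \<in> cones n d then bergman n \<B> \<tau> else 0) = 0" by (simp add: cones_iff)
next
  fix \<tau> m assume \<tau>: "cone n \<tau>" and m: "interpolates n \<tau> (\<lambda>_. 0 :: real) m"
  let ?s = "\<Sum>T\<in>rays n - \<tau>. sum m T *
    (if insert T \<tau> \<in> cones n d then bergman n \<B> (insert T \<tau>) else 0)"
  have sub: "\<tau> \<subseteq> rays n" and fin: "finite \<tau>"
    using \<tau> finite_rays finite_subset by (auto simp: cone_def)
  show "?s = 0"
  proof (cases "card \<tau> = d - 1 \<and> (\<forall>T\<in>\<tau>. flat T)")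
    case True
    then have \<tau>': "\<tau> \<in> cones n (d - 1)" and flats: "\<forall>T\<in>\<tau>. flat T" using \<tau> by (auto simp: cones_iff)
    from flag_gap[OF this] obtain G H where GH: "G \<in> full \<tau>" "H \<in> full \<tau>" "r H = r G + 2" "G \<subseteq> H"
      "r ` full \<tau> = {0..Suc d} - {Suc (r G)}" "\<And>X. X \<in> full \<tau> \<Longrightarrow> X \<subseteq> G \<or> H \<subseteq> X" by blast
    have m0: "sum m X = 0" if "X \<in> full \<tau>" for X using m that by (auto simp: interpolates_def)
    have cone_iff: "insert T \<tau> \<in> cones n d \<longleftrightarrow> is_chain (insert T \<tau>)" if "T \<in> rays n - \<tau>" for T
      using that True sub fin d_pos by (auto simp: cones_def)
    have "?s = (\<Sum>T | T \<in> rays n - \<tau> \<and> is_chain (insert T \<tau>). sum m T * bergman n \<B> (insert T \<tau>))"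
      using finite_rays cone_iff by (intro sum.mono_neutral_cong_right) auto
    also have "\<dots> = (\<Sum>T\<in>between G H. sum m T)"
      using sum_bergman[OF flats] flag_extensions[OF \<tau>' flats GH] by simp
    also have "\<dots> = 0"
      by (simp add: sum_between[OF full_flat[OF flats GH(1)] full_flat[OF flats GH(2)] GH(4,3)]
          m0[OF GH(1)] m0[OF GH(2)])
    finally show ?thesis .
  next
    case False
    \<comment> \<open>Either the larger cone has the wrong dimension or it keeps a member that is
      not a flat.\<close>
    have "(if insert T \<tau> \<in> cones n d then bergman n \<B> (insert T \<tau>) else 0) = 0" if "T \<in> rays n - \<tau>" for T
      using False that fin by (auto simp: cones_def bergman_def)
    then show ?thesis by (intro sum.neutral) auto
  qed
qed

section \<open>Flags in the truncation and the divisor of \<open>h_S\<close>\<close>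

text \<open>A member \<open>A\<close> not containing \<open>S\<close> stops being a flat in the
  truncation when some \<open>cl (insert e A)\<close> contains \<open>S\<close>. Below the gap this
  would put \<open>S\<close> into a flat between \<open>G\<close> and \<open>H\<close>. Conversely,
  if the least member containing \<open>S\<close> had a member one rank below, it would be such a
  closure; so it lies just above the gap and equals \<open>H\<close>.\<close>

lemma truncation_flags:
  assumes \<sigma>: "\<sigma> \<in> cones n (d - 1)" and flats: "\<forall>T\<in>\<sigma>. flat T"
    and GH: "G \<in> full \<sigma>" "H \<in> full \<sigma>" "r H = r G + 2" "G \<subseteq> H"
      "r ` full \<sigma> = {0..Suc d} - {Suc (r G)}" "\<And>X. X \<in> full \<sigma> \<Longrightarrow> X \<subseteq> G \<or> H \<subseteq> X"
    and S: "S \<subseteq> {0..n}" "S \<noteq> {}"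
  shows "S \<subseteq> H \<and> \<not> S \<subseteq> G \<and> \<not> (\<exists>T\<in>between G H. S \<subseteq> T) \<longleftrightarrow>
    r S > 1 \<and> (\<forall>A\<in>\<sigma>. is_flat {0..n} (trunc_bases \<B> (cl S)) A)"
proof -
  have ne: "cl S \<noteq> {}" using cl_superset[OF S(1)] S(2) by blast
  have cl_iff: "cl S \<subseteq> X \<longleftrightarrow> S \<subseteq> X" if "flat X" for X
    using cl_least[OF that] cl_superset[OF S(1)] by blast
  have trunc_flat: "is_flat {0..n} (trunc_bases \<B> (cl S)) A \<longleftrightarrow>
      S \<subseteq> A \<or> (\<forall>e\<in>{0..n} - A. \<not> S \<subseteq> cl (insert e A))" if fA: "flat A" for A
  proof -
    have "cl S \<subseteq> cl (insert e A) \<longleftrightarrow> S \<subseteq> cl (insert e A)" if "e \<in> {0..n} - A" for e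
      by (rule cl_iff[OF cl_flat]) (use fA that in \<open>auto simp: is_flat_def\<close>)
    then show ?thesis
      unfolding truncation_flat_iff[OF cl_ground ne] cl_iff[OF fA] using fA by auto
  qed
  note fG = full_flat[OF flats GH(1)] and fH = full_flat[OF flats GH(2)]
  have sub: "X \<subseteq> {0..n}" if "flat X" for X using that by (simp add: is_flat_def)
  have rank_single: "r {e} = 1" if "e \<in> {0..n}" for e
    using indep_rank[OF indep_singleton[OF that]] by simp
  have cover: "T \<in> between G H \<and> e \<in> T \<longleftrightarrow> T = cl (insert e G)" if "e \<in> H - G" for e T
    by (rule between_unique[OF fG fH GH(4,3) that])
  show ?thesis
  proof
    assume *: "S \<subseteq> H \<and> \<not> S \<subseteq> G \<and> \<not> (\<exists>T\<in>between G H. S \<subseteq> T)"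
    then obtain s where s: "s \<in> S" "s \<in> H - G" by blast
    have sE: "insert s G \<subseteq> {0..n}" using s S sub[OF fG] by blast
    have not_sub: "\<not> S \<subseteq> cl (insert s G)" using * cover[OF s(2)] by blast
    have "r S > 1"
    proof (rule ccontr)
      assume "\<not> 1 < r S"
      \<comment> \<open>In rank at most 1 every element of \<open>S\<close> is spanned by
        \<open>s\<close>, which would put \<open>S\<close> into
        \<open>cl (insert s G)\<close>.\<close>
      then have "r (insert x {s}) = r {s}" if "x \<in> S" for x
        using rank_mono[of "{x, s}" S] rank_insert_ge[of "{s}" x] rank_single[of s] that s(1) S by auto
      then have "r (insert x (insert s G)) = r (insert s G)" if "x \<in> S" for x
        using rank_insert_stable[of x "{s}" "insert s G"] that by simp
      then show False using not_sub S(1) by (auto simp: cl_def)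
    qed
    moreover have "is_flat {0..n} (trunc_bases \<B> (cl S)) A" if A: "A \<in> \<sigma>" for A
    proof -
      have fA: "flat A" using flats A by blast
      have "\<not> S \<subseteq> cl (insert e A)" if AG: "A \<subseteq> G" and e: "e \<in> {0..n} - A" for e
      proof
        assume Se: "S \<subseteq> cl (insert e A)"
        have eG: "insert e G \<subseteq> {0..n}" using e sub[OF fG] by blast
        have Se': "S \<subseteq> cl (insert e G)"
          using Se cl_least[OF cl_flat[OF eG], of "insert e A"] cl_superset[OF eG] AG by blast
        then have le: "cl (insert s G) \<subseteq> cl (insert e G)"
          using cl_least[OF cl_flat[OF eG], of "insert s G"] cl_superset[OF eG] s(1) by blast
        \<comment> \<open>Nested closures are compared by rank; the inequality also covers
          \<open>e \<in> G\<close>.\<close>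
        have "r (cl (insert e G)) \<le> Suc (r G)" using rank_cl[OF eG] rank_insert_le[of e G] by simp
        also have "Suc (r G) \<le> r (insert s G)" using fG s sE by (auto simp: is_flat_def Suc_le_eq)
        also have "\<dots> = r (cl (insert s G))" using rank_cl[OF sE] by simp
        finally have "cl (insert s G) = cl (insert e G)"
          using flat_rank_less[OF cl_flat[OF sE]] le cl_ground by (meson leD psubsetI)
        then show False using Se' not_sub by simp
      qed
      moreover have "S \<subseteq> A" if "H \<subseteq> A" using that * by blast
      ultimately show ?thesis using trunc_flat[OF fA] GH(6)[of A] A by blast
    qed
    ultimately show "r S > 1 \<and> (\<forall>A\<in>\<sigma>. is_flat {0..n} (trunc_bases \<B> (cl S)) A)" by blast
  next
    assume *: "r S > 1 \<and> (\<forall>A\<in>\<sigma>. is_flat {0..n} (trunc_bases \<B> (cl S)) A)"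
    \<comment> \<open>The empty set is not a member of \<open>\<sigma>\<close>; for it
      \<open>r S > 1\<close> takes the place of flatness in the truncation.\<close>
    have no_cover: "\<not> S \<subseteq> cl (insert e A)" if A: "A \<in> full \<sigma>" "\<not> S \<subseteq> A" "e \<in> {0..n} - A" for A e
    proof -
      consider "A = {}" | "A \<in> \<sigma>" using A S(1) by blast
      then show ?thesis
      proof cases
        case 1
        show ?thesis
        proof
          assume "S \<subseteq> cl (insert e A)"
          then have "r S \<le> r (cl {e})" using 1 by (intro rank_mono) simp
          then show False using * rank_cl[of "{e}"] rank_single[of e] A(3) by simp
        qed
      next
        case 2
        then show ?thesis using * trunc_flat[of A] flats A by blast
      qed
    qed
    have "{0..n} \<in> full \<sigma> \<and> S \<subseteq> {0..n}" using S by blast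
    then obtain X where X: "X \<in> full \<sigma>" "S \<subseteq> X"
      and least: "\<And>Y. Y \<in> full \<sigma> \<Longrightarrow> S \<subseteq> Y \<Longrightarrow> r X \<le> r Y"
      using ex_has_least_nat[of "\<lambda>X. X \<in> full \<sigma> \<and> S \<subseteq> X" _ r] by metis
    have fX: "flat X" by (rule full_flat[OF flats X(1)])
    have cmp: "A \<subseteq> B \<longleftrightarrow> r A \<le> r B" "r A = r B \<longleftrightarrow> A = B" if "A \<in> full \<sigma>" "B \<in> full \<sigma>" for A B
    proof -
      have "A \<subseteq> B \<or> B \<subseteq> A" using that \<sigma> unfolding cones_def is_chain_def rays_def by fast
      then show "A \<subseteq> B \<longleftrightarrow> r A \<le> r B" "r A = r B \<longleftrightarrow> A = B"
        using flat_rank_cmp[OF full_flat[OF flats that(1)] full_flat[OF flats that(2)]] by blast+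
    qed
    have "r X > 1" using * rank_mono[OF X(2)] by linarith
    have "r X - 1 \<notin> r ` full \<sigma>"
    proof
      assume "r X - 1 \<in> r ` full \<sigma>"
      then obtain Y where Y: "Y \<in> full \<sigma>" "r X - 1 = r Y" by (rule imageE)
      have YX: "Y \<subset> X" "\<not> S \<subseteq> Y"
        using cmp[OF Y(1) X(1)] least[OF Y(1)] Y(2) \<open>r X > 1\<close> by auto
      then obtain e where e: "e \<in> X - Y" by blast
      have eY: "insert e Y \<subseteq> {0..n}" using e YX sub[OF fX] by blast
      have le: "cl (insert e Y) \<subseteq> X" using cl_least[OF fX] e YX by blast
      have "r Y < r (insert e Y)"
        using full_flat[OF flats Y(1)] e eY by (auto simp: is_flat_def)
      then have "r X \<le> r (cl (insert e Y))" using rank_cl[OF eY] Y(2) by simp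
      then have "cl (insert e Y) = X"
        using flat_rank_less[OF cl_flat[OF eY]] le sub[OF fX] by (meson leD psubsetI)
      then show False using no_cover[OF Y(1) YX(2), of e] X(2) e eY by blast
    qed
    moreover have "r X \<le> Suc d" using rank_mono[OF sub[OF fX]] rank_d by simp
    \<comment> \<open>The only rank missed up to \<open>Suc d\<close> is \<open>Suc (r G)\<close>,
      so \<open>r X - 1\<close> equals it.\<close>
    ultimately have "r X = r H" using GH(3,5) \<open>r X > 1\<close> by auto
    then have "X = H" using cmp(2)[OF X(1) GH(2)] by blast
    moreover have SG: "\<not> S \<subseteq> G" using least[OF GH(1)] GH(3) \<open>r X = r H\<close> by auto
    moreover have "\<not> S \<subseteq> T" if T: "T \<in> between G H" for T
    proof -
      obtain e where e: "e \<in> T" "e \<in> H - G" using T unfolding between_def by blast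
      then have "T = cl (insert e G)" using cover[OF e(2)] T by blast
      then show ?thesis using no_cover[OF GH(1) SG, of e] e sub[OF fH] by blast
    qed
    ultimately show "S \<subseteq> H \<and> \<not> S \<subseteq> G \<and> \<not> (\<exists>T\<in>between G H. S \<subseteq> T)" using X by blast
  qed
qed

text \<open>At a flag of flats the cap product is the sum of \<open>f T - sum m T\<close> over the
  flats \<open>T\<close> filling the gap. The partition of \<open>H - G\<close> evaluates it, and
  \<open>truncation_flags\<close> translates the outcome into flatness in the truncation.\<close>

lemma cap_h_div_bergman:
  assumes \<sigma>: "\<sigma> \<in> cones n (d - 1)" and S: "S \<subseteq> {0..n}" "S \<noteq> {}"
  shows "cap n d (h_div n S) (bergman n \<B>) \<sigma> =
    (if r S > 1 then bergman n (trunc_bases \<B> (cl S)) \<sigma> else 0)"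
proof -
  define f :: "nat set \<Rightarrow> int" where "f = (\<lambda>T. (if 0 \<in> T then 1 else 0) - (if S \<subseteq> T then 1 else 0))"
  have "cone n \<sigma>" using \<sigma> by (simp add: cones_iff)
  then obtain m where m: "interpolates n \<sigma> f m" using cone_interpolation by blast
  have cap: "cap n d (h_div n S) (bergman n \<B>) \<sigma> =
      (\<Sum>T | T \<in> rays n - \<sigma> \<and> is_chain (insert T \<sigma>).
        of_int (f T - sum m T) * bergman n \<B> (insert T \<sigma>))"
    unfolding h_div_eq using cap_eq[OF balanced_bergman \<sigma> d_pos m] unfolding f_def .
  show ?thesis
  proof (cases "\<forall>T\<in>\<sigma>. flat T")
    case flats: True
    from flag_gap[OF \<sigma> flats] obtain G H where GH: "G \<in> full \<sigma>" "H \<in> full \<sigma>" "r H = r G + 2" "G \<subseteq> H"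
      "r ` full \<sigma> = {0..Suc d} - {Suc (r G)}" "\<And>X. X \<in> full \<sigma> \<Longrightarrow> X \<subseteq> G \<or> H \<subseteq> X" by blast
    note gap = full_flat[OF flats GH(1)] full_flat[OF flats GH(2)] GH(4,3)
    \<comment> \<open>So \<open>m\<close> interpolates \<open>f\<close> on the improper flats too,
      and \<open>G\<close> or \<open>H\<close> may be one of them.\<close>
    have "f {} = 0" "f {0..n} = 0" using S by (simp_all add: f_def)
    then have mf: "sum m X = f X" if "X \<in> full \<sigma>" for X
      using m that by (auto simp: interpolates_def)
    have fin: "finite X" if "flat X" for X using that finite_subset by (auto simp: is_flat_def)
    have zero: "sum (\<lambda>i. if i = 0 then 1 else 0) X = (if 0 \<in> X then 1 else 0 :: int)" if "flat X" for X
      using fin[OF that] by simp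
    have "(\<Sum>T\<in>between G H. if 0 \<in> T then 1 else 0 :: int) =
        (\<Sum>T\<in>between G H. sum (\<lambda>i. if i = 0 then 1 else 0) T)"
      by (intro sum.cong refl zero[symmetric]) (simp add: between_def)
    also have "\<dots> = int (card (between G H)) * (if 0 \<in> G then 1 else 0) +
        ((if 0 \<in> H then 1 else 0) - (if 0 \<in> G then 1 else 0))"
      unfolding sum_between[OF gap] zero[OF gap(1)] zero[OF gap(2)] by simp
    finally have alpha: "(\<Sum>T\<in>between G H. if 0 \<in> T then 1 else 0 :: int) = \<dots>" .
    have le_H: "S \<subseteq> H" if "\<exists>T\<in>between G H. S \<subseteq> T" using that by (auto simp: between_def)
    have "(\<Sum>T\<in>between G H. f T - sum m T) = (\<Sum>T\<in>between G H. if 0 \<in> T then 1 else 0)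
        - (\<Sum>T\<in>between G H. if S \<subseteq> T then 1 else 0) - (\<Sum>T\<in>between G H. sum m T)"
      by (simp add: f_def sum_subtractf)
    \<comment> \<open>All terms in the element 0 cancel. For \<open>S \<subseteq> G\<close> the two
      multiples of the number of flats between cancel as well; otherwise the indicator of
      \<open>S \<subseteq> H\<close> minus that of some \<open>T\<close> containing \<open>S\<close>
      remains.\<close>
    also have "\<dots> = (if S \<subseteq> H \<and> \<not> S \<subseteq> G \<and> \<not> (\<exists>T\<in>between G H. S \<subseteq> T) then 1 else 0)"
      unfolding alpha count_between[OF gap] sum_between[OF gap] mf[OF GH(1)] mf[OF GH(2)] f_def
      using GH(4) le_H by (auto simp: algebra_simps)
    finally have "(\<Sum>T\<in>between G H. f T - sum m T) =
        (if r S > 1 \<and> (\<forall>A\<in>\<sigma>. is_flat {0..n} (trunc_bases \<B> (cl S)) A) then 1 else 0)"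
      by (simp only: truncation_flags[OF \<sigma> flats GH S])
    moreover have "cap n d (h_div n S) (bergman n \<B>) \<sigma> = of_int (\<Sum>T\<in>between G H. f T - sum m T)"
      by (simp only: cap sum_bergman[OF flats] flag_extensions[OF \<sigma> flats GH] of_int_sum)
    ultimately show ?thesis by (simp add: bergman_def)
  next
    case False
    have "cl S \<noteq> {}" using cl_superset[OF S(1)] S(2) by blast
    \<comment> \<open>Flats of the truncation are flats of \<open>M\<close>, so a non-flat in
      \<open>\<sigma>\<close> makes both sides 0.\<close>
    then have "bergman n (trunc_bases \<B> (cl S)) \<sigma> = 0"
      using False truncation_flat_iff[OF cl_ground] by (auto simp: bergman_def)
    moreover have "cap n d (h_div n S) (bergman n \<B>) \<sigma> = 0"
      unfolding cap using False by (intro sum.neutral) (auto simp: bergman_def)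
    ultimately show ?thesis by simp
  qed
qed

end

theorem theorem3p11:
  fixes n :: nat and \<B> :: "nat set set" and S :: "nat set"
  assumes "matroid_bases {0..n} \<B>"
    and "loopless {0..n} \<B>"
    and "S \<noteq> {}" and "S \<subseteq> {0..n}"
  defines "F \<equiv> mclosure {0..n} \<B> S"
    and "d \<equiv> matroid_rank \<B> - 1"
  shows "meet_bases {0..n} (H_bases {0..n} S) \<B> = trunc_bases \<B> F
    \<and> (\<forall>\<sigma> \<in> cones n (d - 1). d \<ge> 1 \<longrightarrow>
          cap n d (h_div n S) (bergman n \<B>) \<sigma> =
            (if mrank \<B> S > 1 then bergman n (trunc_bases \<B> F) \<sigma> else 0))"
proof -
  interpret loopless_matroid "{0..n}" \<B>
    using assms(1,2) by unfold_locales
  have F: "F = cl S" unfolding F_def by (rule mclosure_eq_cl[OF assms(4)])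
  have "cap n d (h_div n S) (bergman n \<B>) \<sigma> =
      (if mrank \<B> S > 1 then bergman n (trunc_bases \<B> F) \<sigma> else 0)"
    if "\<sigma> \<in> cones n (d - 1)" "d \<ge> 1" for \<sigma>
  proof -
    \<comment> \<open>\<open>d \<ge> 1\<close> makes the natural subtraction in \<open>d\<close>
      exact, so the rank is \<open>Suc d\<close>.\<close>
    interpret braid_matroid n \<B> d
      using that(2) matroid_rank_eq by unfold_locales (auto simp: d_def)
    show ?thesis unfolding F by (rule cap_h_div_bergman[OF that(1) assms(4,3)])
  qed
  \<comment> \<open>The intersection is the truncation at \<open>S\<close> itself, which has the
    same bases as that at its closure.\<close>
  then show ?thesis
    using meet_H_bases[OF assms(4,3)] trunc_bases_cl[OF assms(4)] by (simp add: F)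
qed

end
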